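(* Let $A$, $B$ be two Blaschke products of the same degree $d$, and let $\zeta\in\mathbb{D}$ be a point which is neither a critical value of $A$ nor a critical value of $B$. Then there exist Blaschke products $A_1$, $B_1$, $C$ with $\deg(C)>1$ such that $A=C\circ A_1$ and $B=C\circ B_1$ if and only if there exist orderings (labellings) $A^{-1}(\zeta)=\{a_1,\dots,a_d\}$ and $B^{-1}(\zeta)=\{b_1,\dots,b_d\}$ for which the equivalence relation $\sim$ on $\{1,\dots,d\}$ (defined in the context) is non-trivial.
   Context: $\mathbb{D}=\{z:|z|<1\}$. A Blaschke product is a rational map of degree $\geq 1$ whose restriction to $\mathbb{D}$ is a proper map onto $\mathbb{D}$. Fibers, critical values and loops are taken in $\mathbb{D}$, i.e. $A,B$ are viewed as branched coverings $\mathbb{D}\to\mathbb{D}$. Monodromy. Fix labellings $A^{-1}(\zeta)=\{a_1,\dots,a_d\}$ and $B^{-1}(\zeta)=\{b_1,\dots,b_d\}$. Let $\gamma:[0,1]\to\mathbb{D}$ be a loop with $\gamma(0)=\gamma(1)=\zeta$ avoiding the critical values of $A$ and of $B$. Define the permutation $\gamma_A^*$ of $\{1,\dots,d\}$ by $\gamma_A^*(i)=j$, where $a_j$ is the terminal point of the unique lift of $\gamma$ under $A$ starting at $a_i$. Define $\gamma_B^*$ in the same way using $B$ and the points $b_1,\dots,b_d$. The relation. Define a relation $\simeq$ on $\{1,\dots,d\}$: whenever there exist such a loop $\gamma$ and an index $i$ with $\gamma_B^*(i)=j$ and $\gamma_A^*(i)=k$, set $j\simeq k$ and $k\simeq j$.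 Let $\sim$ be the equivalence relation generated by $\simeq$: $x\sim y$ iff there is a chain $x=x_0\simeq x_1\simeq\dots\simeq x_n=y$. The relation $\sim$ is called trivial if $j\sim k$ for all $j,k\in\{1,\dots,d\}$, and non-trivial otherwise. The relation $\sim$ depends on the chosen labellings. *)

theory Defs
  imports
    "HOL-Complex_Analysis.Complex_Analysis"
    "HOL-Computational_Algebra.Computational_Algebra"
    "HOL-Computational_Algebra.Field_as_Ring"
begin

text \<open>
  Points of the Riemann sphere are values of type \<open>complex option\<close>, where \<open>None\<close> is infinity
  (the same convention as \<open>Alexandroff_compactification\<close>). \<open>rat_map p q\<close> is the self-map
  \<open>p/q\<close> of the sphere for coprime \<open>p\<close> and \<open>q\<close>; its value at infinity is the quotient of the
  coefficients of index \<open>max (degree p) (degree q)\<close>, at least one of which is nonzero.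
\<close>

definition rat_map :: "complex poly \<Rightarrow> complex poly \<Rightarrow> complex option \<Rightarrow> complex option" where
  "rat_map p q x =
     (case x of
        Some z \<Rightarrow> (if poly q z = 0 then None else Some (poly p z / poly q z))
      | None \<Rightarrow> (let n = max (degree p) (degree q) in
                 if coeff q n = 0 then None else Some (coeff p n / coeff q n)))"

definition rational_map :: "(complex option \<Rightarrow> complex option) \<Rightarrow> bool" where
  "rational_map F \<longleftrightarrow> (\<exists>p q. coprime p q \<and> F = rat_map p q)"

definition rat_degree :: "(complex option \<Rightarrow> complex option) \<Rightarrow> nat" where
  "rat_degree F = (THE n. \<exists>p q. coprime p q \<and> F = rat_map p q \<and> n = max (degree p) (degree q))"

lemma rat_map_eq_imp_degree_eq:
  assumes "coprime p q" "coprime r s" "rat_map p q = rat_map r s"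
  shows "degree p = degree r" "degree q = degree s"
proof -
  have "poly (p * s) z = poly (r * q) z" for z
    using fun_cong[OF assms(3), of "Some z"]
    by (auto simp: rat_map_def divide_simps split: if_splits)
  then have eq: "p * s = r * q"
    using poly_eq_poly_eq_iff by blast
  have "p dvd r" "r dvd p" "q dvd s" "s dvd q"
    using assms(1,2) eq coprime_commute
    by (metis coprime_dvd_mult_left_iff dvd_triv_left dvd_triv_right mult.commute)+
  then show "degree p = degree r" "degree q = degree s"
    by (metis dvd_0_left_iff dvd_imp_degree_le le_antisym)+
qed

lemma rat_degree_rat_map:
  assumes "coprime p q"
  shows "rat_degree (rat_map p q) = max (degree p) (degree q)"
  unfolding rat_degree_def
  by (rule the_equality) (use assms rat_map_eq_imp_degree_eq in metis)+

definition disk_map :: "(complex option \<Rightarrow> complex option) \<Rightarrow> complex \<Rightarrow> complex" where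
  "disk_map F z = the (F (Some z))"

text \<open>
  The image condition is stated on the sphere, so that it also excludes poles in the disk. By
  \<open>proper_map_alt\<close>, preimages of compact sets under a \<open>proper_map\<close> are compact.
\<close>

definition blaschke_product :: "(complex option \<Rightarrow> complex option) \<Rightarrow> bool" where
  "blaschke_product F \<longleftrightarrow>
     rational_map F \<and> rat_degree F \<ge> 1 \<and>
     F ` (Some ` ball 0 1) = Some ` ball 0 1 \<and>
     proper_map (top_of_set (ball 0 1)) (top_of_set (ball 0 1)) (disk_map F)"

definition critical_values :: "(complex option \<Rightarrow> complex option) \<Rightarrow> complex set" where
  "critical_values F = {disk_map F z | z. z \<in> ball 0 1 \<and> deriv (disk_map F) z = 0}"

definition fiber :: "(complex option \<Rightarrow> complex option) \<Rightarrow> complex \<Rightarrow> complex set" where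
  "fiber F w = {z \<in> ball 0 1. disk_map F z = w}"

definition labelling ::
  "(complex option \<Rightarrow> complex option) \<Rightarrow> complex \<Rightarrow> nat \<Rightarrow> (nat \<Rightarrow> complex) \<Rightarrow> bool" where
  "labelling F w d a \<longleftrightarrow> bij_betw a {1..d} (fiber F w)"

definition admissible_loop ::
  "(complex option \<Rightarrow> complex option) \<Rightarrow> (complex option \<Rightarrow> complex option) \<Rightarrow> complex
     \<Rightarrow> (real \<Rightarrow> complex) \<Rightarrow> bool" where
  "admissible_loop A B w \<gamma> \<longleftrightarrow>
     path \<gamma> \<and> path_image \<gamma> \<subseteq> ball 0 1 \<and> pathstart \<gamma> = w \<and> pathfinish \<gamma> = w \<and>
     path_image \<gamma> \<inter> (critical_values A \<union> critical_values B) = {}"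

definition is_lift ::
  "(complex option \<Rightarrow> complex option) \<Rightarrow> (real \<Rightarrow> complex) \<Rightarrow> (real \<Rightarrow> complex) \<Rightarrow> bool" where
  "is_lift F \<gamma> g \<longleftrightarrow>
     path g \<and> path_image g \<subseteq> ball 0 1 \<and> (\<forall>t\<in>{0..1}. disk_map F (g t) = \<gamma> t)"

definition monodromy ::
  "(complex option \<Rightarrow> complex option) \<Rightarrow> nat \<Rightarrow> (nat \<Rightarrow> complex) \<Rightarrow> (real \<Rightarrow> complex)
     \<Rightarrow> nat \<Rightarrow> nat" where
  "monodromy F d a \<gamma> i =
     (THE j. j \<in> {1..d} \<and> (\<exists>g. is_lift F \<gamma> g \<and> pathstart g = a i \<and> pathfinish g = a j))"

definition simeq_rel ::
  "(complex option \<Rightarrow> complex option) \<Rightarrow> (complex option \<Rightarrow> complex option) \<Rightarrow> complex \<Rightarrow> nat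
     \<Rightarrow> (nat \<Rightarrow> complex) \<Rightarrow> (nat \<Rightarrow> complex) \<Rightarrow> nat \<Rightarrow> nat \<Rightarrow> bool" where
  "simeq_rel A B w d a b j k \<longleftrightarrow>
     (\<exists>\<gamma> i. admissible_loop A B w \<gamma> \<and> i \<in> {1..d} \<and>
        (monodromy B d b \<gamma> i = j \<and> monodromy A d a \<gamma> i = k \<or>
         monodromy B d b \<gamma> i = k \<and> monodromy A d a \<gamma> i = j))"

text \<open>\<open>simeq_rel\<close> is symmetric, so its reflexive transitive closure is an equivalence relation.\<close>

definition sim_rel ::
  "(complex option \<Rightarrow> complex option) \<Rightarrow> (complex option \<Rightarrow> complex option) \<Rightarrow> complex \<Rightarrow> nat
     \<Rightarrow> (nat \<Rightarrow> complex) \<Rightarrow> (nat \<Rightarrow> complex) \<Rightarrow> nat \<Rightarrow> nat \<Rightarrow> bool" where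
  "sim_rel A B w d a b = (simeq_rel A B w d a b)\<^sup>*\<^sup>*"

definition trivial_rel_on :: "nat \<Rightarrow> (nat \<Rightarrow> nat \<Rightarrow> bool) \<Rightarrow> bool" where
  "trivial_rel_on d R \<longleftrightarrow> (\<forall>j\<in>{1..d}. \<forall>k\<in>{1..d}. R j k)"

end

theory Submission
  imports Defs
begin

text \<open>
  If \<open>A = C \<circ> A\<^sub>1\<close> and \<open>B = C \<circ> B\<^sub>1\<close>, label the fibers so that \<open>A\<^sub>1 (a i) = B\<^sub>1 (b i)\<close>. A lift under
  \<open>A\<close> or \<open>B\<close> is mapped by \<open>A\<^sub>1\<close> or \<open>B\<^sub>1\<close> to the lift under \<open>C\<close>, so \<open>j \<sim> k\<close> forces
  \<open>A\<^sub>1 (a j) = A\<^sub>1 (a k)\<close>, and there are \<open>deg C > 1\<close> possible values.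

  Conversely, the monodromy of \<open>A\<close> preserves \<open>\<sim>\<close>, and the monodromies of \<open>A\<close> and \<open>B\<close> act alike on the
  classes. Choose a class \<open>K\<close> of least cardinality, \<open>j \<in> K\<close>, and the disk automorphism \<open>\<sigma>\<close> vanishing at
  \<open>a j\<close>. Transport a class along a path under \<open>A\<close> and take the product of \<open>\<sigma>\<close> over its points: this
  is a single-valued bounded function both of the endpoints of the lifts under \<open>A\<close> and of those under
  \<open>B\<close>, with modulus tending to one at the circle, hence it yields Blaschke products \<open>A\<^sub>1\<close> and \<open>B\<^sub>1\<close>.
  The product of \<open>\<sigma>\<close> over a whole fiber of \<open>A\<close> is comparable to \<open>A - \<zeta>\<close>, so the zeros of \<open>A\<^sub>1\<close> are simple
  and \<open>deg A\<^sub>1 = card K\<close>. Therefore generic fibers of \<open>A\<^sub>1\<close> are transported classes, on which \<open>A\<close> is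
  constant, and \<open>A\<close> factors as \<open>C \<circ> A\<^sub>1\<close>; the same \<open>C\<close> serves for \<open>B\<close>.
\<close>

section \<open>Functions of modulus one at the unit circle\<close>

text \<open>A transported class is permuted by monodromy, so only symmetric functions of its points
  are single-valued. Among these, the product of disk automorphisms also stays in the disk and keeps
  the boundary modulus one; a bounded function of this kind extends over finitely many punctures and
  is a finite product of Moebius factors, hence rational. The obstacle is that the product might
  take one value on different classes, which would make the degree of the resulting map too large.
  Centring \<open>\<sigma>\<close> at \<open>a j0\<close> settles the matter over a single value: a
  zero means that the transported class contains \<open>a j0\<close>. The degree found over 0 then
  bounds every fiber, and minimality of the class says that a transported class, whichever it is,
  has enough points to fill the fiber. Both maps are built from lifts under \<open>A\<close>; for
  \<open>B\<close> only the label of the starting point is read off in the fiber of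
  \<open>B\<close>. Over the same path and label the two maps therefore agree, which is why one left
  factor serves both.\<close>

abbreviation at_circle :: "complex filter" where
  "at_circle \<equiv> filtercomap norm (at_left (1::real))"

lemma norm_between:
  fixes s :: real
  assumes "s < 1"
  obtains w :: complex where "s < norm w" "norm w < 1"
proof -
  obtain r where "max s 0 < r" "r < 1"
    using dense[of "max s 0" 1] assms by auto
  then show ?thesis
    by (intro that[of "of_real r"]) auto
qed

text \<open>The filter describes approach to the circle uniformly in the argument: an eventual
  property holds on a whole annulus inside the disk.\<close>

lemma eventually_at_circle:
  "eventually P at_circle \<longleftrightarrow> (\<exists>s<1. \<forall>z. s < norm z \<and> norm z < 1 \<longrightarrow> P z)"
proof
  assume "eventually P at_circle"
  then show "\<exists>s<1. \<forall>z. s < norm z \<and> norm z < 1 \<longrightarrow> P z"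
    unfolding eventually_filtercomap eventually_at_left_field by blast
next
  assume "\<exists>s<1. \<forall>z. s < norm z \<and> norm z < 1 \<longrightarrow> P z"
  then obtain s where "s < 1" "\<And>z. s < norm z \<Longrightarrow> norm z < 1 \<Longrightarrow> P z"
    by blast
  then show "eventually P at_circle"
    unfolding eventually_filtercomap eventually_at_left_field
    by (intro exI[of _ "\<lambda>r. s < r \<and> r < 1"]) auto
qed

lemma eventually_at_circle_disk: "eventually (\<lambda>z. z \<in> ball 0 1) at_circle"
  unfolding eventually_at_circle by (rule exI[of _ 0]) auto

lemma eventually_at_circle_avoid_finite:
  assumes "finite E"
  shows "eventually (\<lambda>z. z \<notin> E) at_circle"
  using assms
proof induction
  case (insert x E)
  have "eventually (\<lambda>z. z \<noteq> x) at_circle"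
  proof (cases "norm x < 1")
    case True
    then show ?thesis
      unfolding eventually_at_circle by (intro exI[of _ "norm x"]) auto
  next
    case False
    then show ?thesis
      unfolding eventually_at_circle by (intro exI[of _ 0]) auto
  qed
  with insert.IH show ?case
    by eventually_elim auto
qed auto

text \<open>By uniform continuity on the closed disk, \<open>f z\<close> is close to the value of
  \<open>f\<close> at the radial projection of \<open>z\<close>, which is at distance
  \<open>1 - norm z\<close>.\<close>

lemma tendsto_norm_at_circle:
  fixes f :: "complex \<Rightarrow> complex"
  assumes cont: "continuous_on (cball 0 1) f"
    and one: "\<And>z. norm z = 1 \<Longrightarrow> norm (f z) = 1"
  shows "((\<lambda>z. norm (f z)) \<longlongrightarrow> 1) at_circle"
proof (rule tendstoI)
  fix e :: real assume "e > 0"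
  have "uniformly_continuous_on (cball 0 1) f"
    by (intro compact_uniformly_continuous cont) auto
  then obtain d where "d > 0" and
    d: "\<And>x y. x \<in> cball 0 1 \<Longrightarrow> y \<in> cball 0 1 \<Longrightarrow> dist x y < d \<Longrightarrow> dist (f x) (f y) < e"
    using \<open>e > 0\<close> unfolding uniformly_continuous_on_def by metis
  \<comment> \<open>The maximum with 0 excludes the origin, which has no radial projection.\<close>
  have "dist (norm (f z)) 1 < e" if "max (1 - d) 0 < norm z" "norm z < 1" for z
  proof -
    define u where "u = z / of_real (norm z)"
    have "z \<noteq> 0" using that by auto
    then have u: "norm u = 1" by (simp add: u_def norm_divide)
    have "z - u = (of_real (norm z) - 1) * u"
      using \<open>z \<noteq> 0\<close> by (simp add: u_def field_simps)
    then have "dist z u = \<bar>norm z - 1\<bar>"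
      using u by (metis dist_norm mult.right_neutral norm_mult norm_of_real of_real_1 of_real_diff)
    then have "dist (f z) (f u) < e"
      using that u by (intro d) auto
    then show ?thesis
      using one[OF u] norm_triangle_ineq3[of "f z" "f u"] by (simp add: dist_norm)
  qed
  then show "\<forall>\<^sub>F z in at_circle. dist (norm (f z)) 1 < e"
    unfolding eventually_at_circle using \<open>d > 0\<close> by (intro exI[of _ "max (1 - d) 0"]) auto
qed

text \<open>On the circle \<open>z * cnj z = 1\<close>, so the denominator is \<open>z\<close> times
  the conjugate of the numerator.\<close>

lemma norm_Moebius_circle:
  assumes "norm a < 1" "norm z = 1"
  shows "norm (Moebius_function 0 a z) = 1"
proof -
  have "z * cnj z = 1"
    using assms by (metis complex_norm_square of_real_1 one_power2)
  then have "1 - cnj a * z = z * cnj (z - a)"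
    by (simp add: algebra_simps)
  then have "norm (1 - cnj a * z) = norm (z - a)"
    using assms by (metis complex_mod_cnj mult_1 norm_mult)
  moreover have "z \<noteq> a"
    using assms by auto
  ultimately show ?thesis
    by (simp add: Moebius_function_simple norm_divide)
qed

lemma Moebius_denominator_nonzero:
  assumes "norm a < 1" "norm z \<le> 1"
  shows "1 - cnj a * z \<noteq> 0"
proof
  assume "1 - cnj a * z = 0"
  then have "norm (cnj a * z) = 1"
    by (metis eq_iff_diff_eq_0 norm_one)
  moreover have "norm a * norm z \<le> norm a * 1"
    using assms by (intro mult_left_mono) auto
  ultimately show False
    using assms by (simp add: norm_mult)
qed

lemma Moebius_function_eq_0_iff:
  assumes "norm a < 1" "norm z < 1"
  shows "Moebius_function 0 a z = 0 \<longleftrightarrow> z = a"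
  using Moebius_denominator_nonzero[of a z] assms by (auto simp: Moebius_function_simple)

lemma tendsto_norm_Moebius_at_circle:
  assumes "norm a < 1"
  shows "((\<lambda>z. norm (Moebius_function 0 a z)) \<longlongrightarrow> 1) at_circle"
proof (rule tendsto_norm_at_circle)
  show "continuous_on (cball 0 1) (Moebius_function 0 a)"
    unfolding Moebius_function_simple
    using Moebius_denominator_nonzero[OF assms] by (intro continuous_intros) auto
qed (use assms norm_Moebius_circle in auto)

text \<open>Nothing is known on the unit circle itself, so the maximum principle is applied on a
  disk of radius \<open>r < 1\<close> that contains \<open>z\<close> and whose boundary lies in the
  annulus where the modulus is below \<open>1 + e\<close>.\<close>

lemma norm_le_1_of_tendsto_at_circle:
  assumes hol: "f holomorphic_on ball 0 1"
    and lim: "((\<lambda>z. norm (f z)) \<longlongrightarrow> 1) at_circle"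
    and z: "z \<in> ball 0 1"
  shows "norm (f z) \<le> 1"
proof (rule field_le_epsilon)
  fix e :: real assume "e > 0"
  then have "\<forall>\<^sub>F z in at_circle. norm (f z) < 1 + e"
    using order_tendstoD(2)[OF lim] by simp
  then obtain s where "s < 1" and s: "\<And>z. s < norm z \<Longrightarrow> norm z < 1 \<Longrightarrow> norm (f z) < 1 + e"
    unfolding eventually_at_circle by blast
  obtain r where r: "max s (norm z) < r" "r < 1"
    using dense[of "max s (norm z)" 1] \<open>s < 1\<close> z by auto
  then have "r > 0" using norm_ge_zero[of z] by linarith
  show "norm (f z) \<le> 1 + e"
  proof (rule maximum_modulus_frontier[of f "ball 0 r"])
    show "f holomorphic_on interior (ball 0 r)"
      using hol r by (auto intro: holomorphic_on_subset)
    have "f holomorphic_on cball 0 r"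
      using hol r by (auto intro: holomorphic_on_subset)
    then show "continuous_on (closure (ball 0 r)) f"
      using \<open>r > 0\<close> by (simp add: holomorphic_on_imp_continuous_on)
    show "norm (f w) \<le> 1 + e" if "w \<in> frontier (ball 0 r)" for w
      using that \<open>r > 0\<close> r s[of w] by (simp add: less_imp_le)
  qed (use r in auto)
qed

text \<open>The previous bound applies to \<open>f\<close> and to its inverse, so the modulus is
  identically one and attains its maximum at the centre.\<close>

lemma constant_of_nonzero_tendsto_at_circle:
  assumes hol: "f holomorphic_on ball 0 1"
    and lim: "((\<lambda>z. norm (f z)) \<longlongrightarrow> 1) at_circle"
    and nz: "\<And>z. z \<in> ball 0 1 \<Longrightarrow> f z \<noteq> 0"
  obtains c where "norm c = 1" "\<And>z. z \<in> ball 0 1 \<Longrightarrow> f z = c"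
proof -
  have "((\<lambda>z. norm (inverse (f z))) \<longlongrightarrow> 1) at_circle"
    using tendsto_inverse[OF lim] by (simp add: norm_inverse)
  then have "norm (inverse (f z)) \<le> 1" if "z \<in> ball 0 1" for z
    using that nz by (intro norm_le_1_of_tendsto_at_circle holomorphic_intros hol) auto
  then have ge: "1 \<le> norm (f z)" if "z \<in> ball 0 1" for z
    using that nz by (metis inverse_inverse_eq norm_inverse one_le_inverse zero_less_norm_iff
        nonzero_imp_inverse_nonzero)
  have le: "norm (f z) \<le> 1" if "z \<in> ball 0 1" for z
    using norm_le_1_of_tendsto_at_circle[OF hol lim that] .
  have "f constant_on ball 0 1"
  proof (rule maximum_modulus_principle[OF hol, of "ball 0 1" 0])
    show "norm (f w) \<le> norm (f 0)" if "w \<in> ball 0 1" for w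
      using le[OF that] ge[of 0] by simp
  qed auto
  then obtain c where "\<And>z. z \<in> ball 0 1 \<Longrightarrow> f z = c"
    unfolding constant_on_def by blast
  with that[of c] show ?thesis
    using ge[of 0] le[of 0] by force
qed

text \<open>Induction on the number of distinct zeros. Dividing by the full power of a Moebius
  factor removes one zero and changes neither holomorphy nor the boundary modulus; a function
  without zeros is constant.\<close>

lemma factorization_by_zeros:
  assumes hol: "f holomorphic_on ball 0 1"
    and lim: "((\<lambda>z. norm (f z)) \<longlongrightarrow> 1) at_circle"
  obtains c xs where "norm c = 1" "set xs \<subseteq> ball 0 1"
    "\<And>z. z \<in> ball 0 1 \<Longrightarrow> f z = c * (\<Prod>a\<leftarrow>xs. Moebius_function 0 a z)"
proof -
  \<comment> \<open>Near the circle the modulus is close to one, so all zeros lie in a smaller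
    closed disk.\<close>
  have fin: "finite {z \<in> ball 0 1. f z = 0}"
    if hol: "f holomorphic_on ball 0 1" and lim: "((\<lambda>z. norm (f z)) \<longlongrightarrow> 1) at_circle" for f
  proof -
    have "\<forall>\<^sub>F z in at_circle. norm (f z) > 0"
      using order_tendstoD(1)[OF lim, of 0] by simp
    then obtain s where s: "s < 1" "\<And>z. s < norm z \<Longrightarrow> norm z < 1 \<Longrightarrow> f z \<noteq> 0"
      unfolding eventually_at_circle by force
    have sub: "{z \<in> ball 0 1. f z = 0} \<subseteq> {z \<in> cball 0 s. f z = 0}"
      using s by force
    show ?thesis
    proof (cases "f constant_on ball 0 1")
      case True
      obtain w :: complex where "s < norm w" "norm w < 1"
        using norm_between[OF s(1)] .
      with s True have "{z \<in> ball 0 1. f z = 0} = {}"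
        unfolding constant_on_def by (metis (mono_tags, lifting) Collect_empty_eq dist_0_norm mem_ball)
      then show ?thesis by (metis finite.emptyI)
    next
      case False
      show ?thesis
        by (rule finite_subset[OF sub], rule holomorphic_compact_finite_zeros[OF hol])
           (use s False in auto)
    qed
  qed
  have "\<exists>c xs. norm c = 1 \<and> set xs \<subseteq> ball 0 1 \<and>
      (\<forall>z\<in>ball 0 1. f z = c * (\<Prod>a\<leftarrow>xs. Moebius_function 0 a z))"
    using hol lim
  proof (induction "card {z \<in> ball 0 1. f z = 0}" arbitrary: f)
    case 0
    then have "f z \<noteq> 0" if "z \<in> ball 0 1" for z
      using fin[of f] that by (auto simp: card_eq_0_iff)
    then obtain c where "norm c = 1" "\<And>z. z \<in> ball 0 1 \<Longrightarrow> f z = c"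
      using constant_of_nonzero_tendsto_at_circle[OF 0(2,3)] by blast
    then show ?case
      by (intro exI[of _ c] exI[of _ "[]"]) auto
  next
    case (Suc n)
    then have "{z \<in> ball 0 1. f z = 0} \<noteq> {}"
      by (metis card.empty nat.distinct(1))
    then obtain a where a: "a \<in> ball 0 1" "f a = 0"
      by blast
    have "\<exists>w\<in>ball 0 1. f w \<noteq> 0"
    proof -
      have "\<forall>\<^sub>F z in at_circle. norm (f z) > 0"
        using order_tendstoD(1)[OF Suc.prems(2), of 0] by simp
      then obtain s where s: "s < 1" "\<And>z. s < norm z \<Longrightarrow> norm z < 1 \<Longrightarrow> f z \<noteq> 0"
        unfolding eventually_at_circle by force
      obtain w :: complex where "s < norm w" "norm w < 1"
        using norm_between[OF s(1)] .
      with s show ?thesis by force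
    qed
    then obtain r h k where r: "r > 0" "cball a r \<subseteq> ball 0 1" and h: "h holomorphic_on cball a r"
      and fh: "\<And>w. w \<in> cball a r \<Longrightarrow> f w = h w * (w - a) ^ k \<and> h w \<noteq> 0" and "k > 0"
      using zorder_exist_zero[OF Suc.prems(1) _ _ a(1)] a(2)
      by (metis connected_ball nat_0_iff not_gr_zero open_ball linorder_not_le)
    \<comment> \<open>The quotient of \<open>f\<close> by the \<open>k\<close>-th power of the
      Moebius factor at \<open>a\<close>, with the removable singularity filled in by
      \<open>h a\<close>.\<close>
    define g where "g = (\<lambda>z. (if z = a then h a else f z / (z - a) ^ k) * (1 - cnj a * z) ^ k)"
    have g_eq: "g z = h z * (1 - cnj a * z) ^ k" if "z \<in> cball a r" for z
      using fh[OF that] by (auto simp: g_def)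
    have gf: "f z = g z * Moebius_function 0 a z ^ k" if "z \<in> ball 0 1" for z
      using that a \<open>k > 0\<close> Moebius_denominator_nonzero[of a z]
      by (auto simp: g_def Moebius_function_simple power_divide)
    have "g holomorphic_on ball 0 1 - {a}"
    proof (rule holomorphic_transform)
      show "(\<lambda>z. f z / (z - a) ^ k * (1 - cnj a * z) ^ k) holomorphic_on ball 0 1 - {a}"
        using Suc.prems(1) by (intro holomorphic_intros) (auto intro: holomorphic_on_subset)
    qed (auto simp: g_def)
    moreover have "g holomorphic_on ball a r"
    proof (rule holomorphic_transform)
      show "(\<lambda>z. h z * (1 - cnj a * z) ^ k) holomorphic_on ball a r"
        using h by (intro holomorphic_intros) (auto intro: holomorphic_on_subset)
    qed (use g_eq in auto)
    ultimately have "g holomorphic_on (ball 0 1 - {a}) \<union> ball a r"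
      by (intro holomorphic_on_Un) auto
    then have g: "g holomorphic_on ball 0 1"
      by (rule holomorphic_on_subset) (use r in auto)
    have "((\<lambda>z. norm (f z) / norm (Moebius_function 0 a z) ^ k) \<longlongrightarrow> 1 / 1 ^ k) at_circle"
      using a by (intro tendsto_intros Suc.prems tendsto_norm_Moebius_at_circle) auto
    moreover have "\<forall>\<^sub>F z in at_circle. z \<notin> {a}"
      by (rule eventually_at_circle_avoid_finite) simp
    then have "\<forall>\<^sub>F z in at_circle. norm (f z) / norm (Moebius_function 0 a z) ^ k = norm (g z)"
      using eventually_at_circle_disk
    proof eventually_elim
      case (elim z)
      then show ?case
        using gf[of z] a Moebius_function_eq_0_iff[of a z] by (simp add: norm_mult norm_power)
    qed
    ultimately have lim: "((\<lambda>z. norm (g z)) \<longlongrightarrow> 1) at_circle"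
      by (simp add: filterlim_cong)
    have "g z = 0 \<longleftrightarrow> f z = 0 \<and> z \<noteq> a" if "z \<in> ball 0 1" for z
    proof (cases "z = a")
      case True
      have "h a \<noteq> 0" "1 - cnj a * a \<noteq> 0"
        using fh[of a] r a Moebius_denominator_nonzero[of a a] by auto
      then show ?thesis using True by (simp add: g_def)
    next
      case False
      then show ?thesis
        using gf[OF that] Moebius_function_eq_0_iff[of a z] a that by auto
    qed
    then have "{z \<in> ball 0 1. g z = 0} = {z \<in> ball 0 1. f z = 0} - {a}"
      by auto
    then have "n = card {z \<in> ball 0 1. g z = 0}"
      using Suc.hyps(2) a fin[OF Suc.prems] by simp
    from Suc.hyps(1)[OF this g lim]
    obtain c xs where c: "norm c = 1" "set xs \<subseteq> ball 0 1"
        "\<And>z. z \<in> ball 0 1 \<Longrightarrow> g z = c * (\<Prod>a\<leftarrow>xs. Moebius_function 0 a z)"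
      by blast
    have "f z = c * (\<Prod>a\<leftarrow>replicate k a @ xs. Moebius_function 0 a z)" if "z \<in> ball 0 1" for z
      using gf[OF that] c(3)[OF that] by (simp add: prod_list_replicate map_replicate_const mult_ac)
    then show ?case
      using c(1,2) a by (intro exI[of _ c] exI[of _ "replicate k a @ xs"]) auto
  qed
  with that show ?thesis by blast
qed

section \<open>Quotients of polynomials that are unimodular on the circle\<close>

text \<open>The reciprocal polynomial of formal degree \<open>n\<close>, that is
  \<open>z ^ n * cnj (p (1 / cnj z))\<close>. It turns statements about \<open>cnj (p z)\<close> on
  the circle into polynomial identities.\<close>

definition cnj_reverse_poly :: "nat \<Rightarrow> complex poly \<Rightarrow> complex poly" where
  "cnj_reverse_poly n p = (\<Sum>k\<le>n. monom (cnj (coeff p k)) (n - k))"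

lemma poly_cnj_reverse_poly:
  assumes "degree p \<le> n" "z \<noteq> 0"
  shows "poly (cnj_reverse_poly n p) z = z ^ n * cnj (poly p (1 / cnj z))"
proof -
  have "poly p w = (\<Sum>k\<le>n. coeff p k * w ^ k)" for w
    using assms(1) by (subst poly_altdef, intro sum.mono_neutral_left) (auto simp: coeff_eq_0)
  then have "z ^ n * cnj (poly p (1 / cnj z)) = (\<Sum>k\<le>n. cnj (coeff p k) * (z ^ n / z ^ k))"
    by (simp add: sum_distrib_left power_divide mult_ac)
  also have "\<dots> = (\<Sum>k\<le>n. cnj (coeff p k) * z ^ (n - k))"
    using assms(2) by (intro sum.cong refl) (simp add: power_diff)
  finally show ?thesis
    by (simp add: cnj_reverse_poly_def poly_sum poly_monom)
qed

lemma poly_cnj_reverse_poly_0: "poly (cnj_reverse_poly n p) 0 = cnj (coeff p n)"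
proof -
  have "poly (cnj_reverse_poly n p) 0 = (\<Sum>k\<le>n. cnj (coeff p k) * 0 ^ (n - k))"
    by (simp add: cnj_reverse_poly_def poly_sum poly_monom)
  also have "\<dots> = (\<Sum>k\<le>n. if k = n then cnj (coeff p k) else 0)"
    by (intro sum.cong refl) (auto simp: power_0_left)
  finally show ?thesis by simp
qed

text \<open>Reflection of the sphere in the unit circle, which exchanges the disk with its
  exterior.\<close>

fun sphere_reflect :: "complex option \<Rightarrow> complex option" where
  "sphere_reflect None = Some 0"
| "sphere_reflect (Some z) = (if z = 0 then None else Some (1 / cnj z))"

lemma infinite_unit_circle: "infinite {z :: complex. norm z = 1}"
proof
  assume "finite {z :: complex. norm z = 1}"
  moreover have "sphere (0::complex) 1 = {z. norm z = 1}" by auto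
  moreover have "connected (sphere (0::complex) 1)"
    by (rule connected_sphere) simp
  moreover have "(1::complex) \<in> sphere 0 1" "(-1::complex) \<in> sphere 0 1" by auto
  ultimately show False
    by (metis connected_finite_iff_sing empty_iff insert_iff one_neq_neg_one)
qed

text \<open>Blaschke products in polynomial terms. The moduli are compared without division; poles
  on the circle are then excluded by coprimality.\<close>

locale blaschke_quotient =
  fixes p q :: "complex poly"
  assumes coprime: "coprime p q"
    and degree_pos: "0 < max (degree p) (degree q)"
    and norm_less: "norm z < 1 \<Longrightarrow> norm (poly p z) < norm (poly q z)"
    and norm_eq: "norm z = 1 \<Longrightarrow> norm (poly p z) = norm (poly q z)"
begin

abbreviation N :: nat where
  "N \<equiv> max (degree p) (degree q)"

lemma common_root: "poly p z = 0 \<Longrightarrow> poly q z \<noteq> 0"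
  using coprime coprime_poly_0 by blast

lemma q_nonzero: "norm z \<le> 1 \<Longrightarrow> poly q z \<noteq> 0"
  using norm_less[of z] norm_eq[of z] common_root[of z]
  by (cases "norm z < 1") auto

text \<open>On the circle \<open>1 / cnj z = z\<close>, so the two sides are \<open>z ^ N\<close>
  times the squared moduli of \<open>p\<close> and \<open>q\<close>. Polynomials that agree on an
  infinite set are equal.\<close>

lemma reflection_identity:
  "cnj_reverse_poly N p * p = cnj_reverse_poly N q * q"
proof -
  have "poly (cnj_reverse_poly N p * p - cnj_reverse_poly N q * q) z = 0" if z: "norm z = 1" for z
  proof -
    have "z \<noteq> 0" using z by auto
    moreover have "z * cnj z = 1"
      using z by (metis complex_norm_square of_real_1 one_power2)
    then have "1 / cnj z = z"
      by (metis nonzero_eq_divide_eq mult_zero_right zero_neq_one)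
    moreover have "cnj (poly p z) * poly p z = cnj (poly q z) * poly q z"
      using norm_eq[OF z] by (metis complex_norm_square mult.commute)
    ultimately show ?thesis
      by (simp add: poly_cnj_reverse_poly mult.assoc)
  qed
  then have "{z. norm z = 1} \<subseteq> {z. poly (cnj_reverse_poly N p * p - cnj_reverse_poly N q * q) z = 0}"
    by auto
  then show ?thesis
    using infinite_unit_circle poly_roots_finite finite_subset
    by (metis eq_iff_diff_eq_0)
qed

text \<open>This is \<open>F (1 / cnj z) = 1 / cnj (F z)\<close> for \<open>F = p / q\<close>,
  cleared of denominators so that it also covers \<open>F z = 0\<close>, where the reflected point
  is a pole.\<close>

lemma reflection:
  assumes "norm z < 1" "z \<noteq> 0"
  shows "poly q (1 / cnj z) = cnj (poly p z / poly q z) * poly p (1 / cnj z)"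
proof -
  have "poly (cnj_reverse_poly N p * p) z = poly (cnj_reverse_poly N q * q) z"
    by (simp only: reflection_identity)
  then have "cnj (poly p (1 / cnj z)) * poly p z = cnj (poly q (1 / cnj z)) * poly q z"
    using assms(2) by (simp add: poly_cnj_reverse_poly)
  then have "cnj (poly q (1 / cnj z)) = (poly p z / poly q z) * cnj (poly p (1 / cnj z))"
    using q_nonzero[of z] assms(1) by (simp add: field_simps)
  then show ?thesis
    by (metis complex_cnj_cnj complex_cnj_mult)
qed

text \<open>The same symmetry for the pair consisting of 0 and infinity, the coefficients of index
  \<open>N\<close> playing the role of values at infinity.\<close>

lemma reflection_0: "coeff q N = cnj (poly p 0 / poly q 0) * coeff p N"
proof -
  have "poly (cnj_reverse_poly N p * p) 0 = poly (cnj_reverse_poly N q * q) 0"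
    by (simp only: reflection_identity)
  then have "cnj (coeff p N) * poly p 0 = cnj (coeff q N) * poly q 0"
    by (simp add: poly_cnj_reverse_poly_0)
  then have "cnj (coeff q N) = (poly p 0 / poly q 0) * cnj (coeff p N)"
    using q_nonzero[of 0] by (simp add: field_simps)
  then show ?thesis
    by (metis complex_cnj_cnj complex_cnj_mult)
qed

lemma coeff_p_nonzero: "coeff p N \<noteq> 0"
proof
  assume "coeff p N = 0"
  moreover from this have "coeff q N = 0"
    using reflection_0 by simp
  ultimately show False
    using degree_pos by (metis degree_0 leading_coeff_0_iff less_irrefl max_def)
qed

lemma rat_map_disk:
  assumes "norm z \<le> 1"
  shows "rat_map p q (Some z) = Some (poly p z / poly q z)"
  using q_nonzero[OF assms] by (simp add: rat_map_def)

lemma disk_map_eq: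
  assumes "norm z \<le> 1"
  shows "disk_map (rat_map p q) z = poly p z / poly q z"
  using rat_map_disk[OF assms] by (simp add: disk_map_def)

lemma rat_map_reflect:
  assumes "norm z < 1"
  shows "rat_map p q (sphere_reflect (Some z)) = sphere_reflect (rat_map p q (Some z))"
proof (cases "z = 0")
  case True
  then show ?thesis
    using reflection_0 coeff_p_nonzero q_nonzero[of 0]
    by (auto simp: rat_map_def Let_def field_simps)
next
  case False
  then show ?thesis
    using reflection[OF assms False] common_root[of "1 / cnj z"] q_nonzero[of z] assms
    by (auto simp: rat_map_def field_simps)
qed

lemma norm_quotient_less: "norm z < 1 \<Longrightarrow> norm (poly p z / poly q z) < 1"
  using norm_less[of z] by (simp add: norm_divide divide_simps)

text \<open>All solutions of \<open>F z = w\<close> on the sphere lie in the disk: on the circle the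
  modulus of \<open>F\<close> is one, and an exterior solution contradicts the reflection
  symmetry.\<close>

lemma norm_root_less:
  assumes w: "norm w < 1" and root: "poly (p - smult w q) z = 0"
  shows "norm z < 1"
proof (rule ccontr)
  assume "\<not> norm z < 1"
  then consider "norm z = 1" | "norm z > 1" by linarith
  then show False
  proof cases
    case 1
    have "norm (poly q z) = norm w * norm (poly q z)"
      using root norm_eq[OF 1] by (simp add: norm_mult)
    then show False using w q_nonzero[of z] 1 by simp
  next
    case 2
    \<comment> \<open>With the root reflected into the disk, the equation becomes
      \<open>p z * (1 - w * cnj (F u)) = 0\<close>, whose second factor is nonzero because
      \<open>w\<close> and \<open>F u\<close> lie in the disk.\<close>
    define u where "u = 1 / cnj z"
    have u: "norm u < 1" "u \<noteq> 0" "1 / cnj u = z"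
      using 2 by (auto simp: u_def norm_divide divide_simps)
    have "poly q z = cnj (poly p u / poly q u) * poly p z"
      using reflection[OF u(1,2)] u(3) by simp
    then have "poly p z * (1 - w * cnj (poly p u / poly q u)) = 0"
      using root by (simp add: algebra_simps)
    moreover have "norm (w * cnj (poly p u / poly q u)) < 1"
      using norm_quotient_less[OF u(1)] w
      by (metis complex_mod_cnj mult_strict_mono' mult_1 norm_ge_zero norm_mult)
    then have "1 - w * cnj (poly p u / poly q u) \<noteq> 0"
      by (metis eq_iff_diff_eq_0 less_irrefl norm_one)
    ultimately have "poly p z = 0"
      by (metis mult_eq_0_iff)
    with \<open>poly q z = _\<close> common_root[of z] show False by simp
  qed
qed

text \<open>Infinity is not a solution of \<open>F z = w\<close> either. Hence
  \<open>p - w q\<close> keeps degree \<open>N\<close> for every \<open>w\<close> in the disk, and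
  its roots count the fiber.\<close>

lemma coeff_diff_nonzero:
  assumes "norm w < 1"
  shows "coeff (p - smult w q) N \<noteq> 0"
proof -
  have "coeff (p - smult w q) N = coeff p N * (1 - w * cnj (poly p 0 / poly q 0))"
    using reflection_0 by (simp add: algebra_simps)
  moreover have "norm (w * cnj (poly p 0 / poly q 0)) < 1"
    using norm_quotient_less[of 0] assms
    by (metis complex_mod_cnj mult_strict_mono' mult_1 norm_ge_zero norm_mult norm_zero zero_less_one)
  then have "1 - w * cnj (poly p 0 / poly q 0) \<noteq> 0"
    by (metis eq_iff_diff_eq_0 less_irrefl norm_one)
  ultimately show ?thesis
    using coeff_p_nonzero by simp
qed

lemma diff_nonzero: "norm w < 1 \<Longrightarrow> p - smult w q \<noteq> 0"
  using coeff_diff_nonzero by (metis coeff_0)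

lemma degree_diff:
  assumes "norm w < 1"
  shows "degree (p - smult w q) = N"
proof (rule antisym)
  show "degree (p - smult w q) \<le> N"
    by (rule degree_diff_le) (auto intro: order_trans[OF degree_smult_le])
  show "N \<le> degree (p - smult w q)"
    by (rule le_degree) (rule coeff_diff_nonzero[OF assms])
qed

lemma fiber_eq_roots:
  assumes "norm w < 1"
  shows "fiber (rat_map p q) w = {z. poly (p - smult w q) z = 0}"
proof -
  have "disk_map (rat_map p q) z = w \<longleftrightarrow> poly (p - smult w q) z = 0" if "norm z < 1" for z
    using q_nonzero[of z] disk_map_eq[of z] that by (simp add: divide_eq_eq)
  then show ?thesis
    using norm_root_less[OF assms] by (auto simp: fiber_def)
qed

lemma finite_fiber:
  assumes "norm w < 1"
  shows "finite (fiber (rat_map p q) w)"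
  unfolding fiber_eq_roots[OF assms]
  by (rule poly_roots_finite[OF diff_nonzero[OF assms]])

lemma card_fiber_le:
  assumes "norm w < 1"
  shows "card (fiber (rat_map p q) w) \<le> N"
  unfolding fiber_eq_roots[OF assms] degree_diff[OF assms, symmetric]
  by (rule card_poly_roots_bound[OF diff_nonzero[OF assms]])

lemma fiber_nonempty:
  assumes "norm w < 1"
  shows "fiber (rat_map p q) w \<noteq> {}"
proof -
  have "\<not> constant (poly (p - smult w q))"
    using degree_diff[OF assms] degree_pos by (metis constant_degree less_irrefl)
  then show ?thesis
    unfolding fiber_eq_roots[OF assms] using fundamental_theorem_of_algebra by blast
qed

lemma disk_map_holomorphic: "disk_map (rat_map p q) holomorphic_on ball 0 1"
proof (rule holomorphic_transform)
  show "(\<lambda>z. poly p z / poly q z) holomorphic_on ball 0 1"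
    using q_nonzero by (intro holomorphic_intros) auto
qed (auto simp: disk_map_eq)

lemma deriv_disk_map:
  assumes "norm z < 1"
  shows "deriv (disk_map (rat_map p q)) z =
    (poly (pderiv p) z * poly q z - poly p z * poly (pderiv q) z) / (poly q z)\<^sup>2"
proof -
  have "((\<lambda>z. poly p z / poly q z) has_field_derivative
      (poly (pderiv p) z * poly q z - poly p z * poly (pderiv q) z) / (poly q z * poly q z)) (at z)"
    using q_nonzero[of z] assms by (intro DERIV_divide poly_DERIV) auto
  then have "(disk_map (rat_map p q) has_field_derivative
      (poly (pderiv p) z * poly q z - poly p z * poly (pderiv q) z) / (poly q z * poly q z)) (at z)"
    by (rule has_field_derivative_transform_within_open[where S = "ball 0 1"])
       (use assms in \<open>auto simp: disk_map_eq\<close>)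
  then show ?thesis
    by (simp add: DERIV_imp_deriv power2_eq_square)
qed

text \<open>A multiple root of \<open>p - w q\<close> satisfies \<open>p = w q\<close> and
  \<open>p' = w q'\<close>, so the numerator \<open>p' q - p q'\<close> of the derivative vanishes
  there.\<close>

lemma rsquarefree_diff:
  assumes "norm w < 1" "w \<notin> critical_values (rat_map p q)"
  shows "rsquarefree (p - smult w q)"
  unfolding rsquarefree_roots
proof (intro allI notI)
  fix z assume z: "poly (p - smult w q) z = 0 \<and> poly (pderiv (p - smult w q)) z = 0"
  then have "norm z < 1" using norm_root_less[OF assms(1)] by blast
  then have "disk_map (rat_map p q) z = w" "poly q z \<noteq> 0"
    using z disk_map_eq[of z] q_nonzero[of z] by (auto simp: field_simps)
  moreover have "deriv (disk_map (rat_map p q)) z = 0"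
    using z deriv_disk_map[OF \<open>norm z < 1\<close>] by (simp add: pderiv_diff pderiv_smult algebra_simps)
  ultimately show False
    using assms(2) \<open>norm z < 1\<close> by (force simp: critical_values_def)
qed

lemma card_fiber:
  assumes "norm w < 1" "w \<notin> critical_values (rat_map p q)"
  shows "card (fiber (rat_map p q) w) = N"
proof -
  let ?r = "p - smult w q"
  have "degree (\<Prod>z|poly ?r z = 0. [:-z, 1:]) = card {z. poly ?r z = 0}"
    by (subst degree_prod_sum_eq) auto
  then have "degree (smult (lead_coeff ?r) (\<Prod>z|poly ?r z = 0. [:-z, 1:])) = card {z. poly ?r z = 0}"
    using diff_nonzero[OF assms(1)] by (simp only: degree_smult_eq leading_coeff_0_iff if_False)
  then show ?thesis
    unfolding complex_poly_decompose_rsquarefree[OF rsquarefree_diff[OF assms]]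
      fiber_eq_roots[OF assms(1)] using degree_diff[OF assms(1)] by simp
qed

text \<open>Critical points are roots of \<open>r\<close>. If \<open>r\<close> were zero,
  coprimality would give that \<open>p\<close> divides its derivative and \<open>q\<close> its own,
  so both would be constant.\<close>

lemma finite_critical_values: "finite (critical_values (rat_map p q))"
proof -
  define r where "r = pderiv p * q - p * pderiv q"
  have "r \<noteq> 0"
  proof
    assume "r = 0"
    then have eq: "pderiv p * q = p * pderiv q" by (simp add: r_def)
    have "p dvd pderiv p * q" unfolding eq by simp
    then have "p dvd pderiv p"
      using coprime by (simp add: coprime_dvd_mult_left_iff)
    moreover have "q dvd p * pderiv q" unfolding eq[symmetric] by simp
    then have "q dvd pderiv q"
      using coprime by (simp add: coprime_dvd_mult_right_iff coprime_commute)
    ultimately have "degree p = 0" "degree q = 0"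
      using not_dvd_pderiv[of p] not_dvd_pderiv[of q] by auto
    then show False using degree_pos by simp
  qed
  then have "finite {z. poly r z = 0}"
    by (rule poly_roots_finite)
  moreover have "critical_values (rat_map p q) \<subseteq> disk_map (rat_map p q) ` {z. poly r z = 0}"
    using q_nonzero by (auto simp: critical_values_def deriv_disk_map r_def)
  ultimately show ?thesis
    using finite_surj by blast
qed

lemma prod_fiber:
  assumes "norm w < 1" "w \<notin> critical_values (rat_map p q)"
  shows "norm (\<Prod>u\<in>fiber (rat_map p q) w. x - u) * norm (coeff (p - smult w q) N) = norm (poly (p - smult w q) x)"
proof -
  let ?r = "p - smult w q"
  have "poly ?r x = poly (smult (lead_coeff ?r) (\<Prod>z|poly ?r z = 0. [:-z, 1:])) x"
    unfolding complex_poly_decompose_rsquarefree[OF rsquarefree_diff[OF assms]] ..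
  also have "\<dots> = coeff ?r N * (\<Prod>u\<in>fiber (rat_map p q) w. x - u)"
    unfolding fiber_eq_roots[OF assms(1)] degree_diff[OF assms(1)] by (simp add: poly_prod)
  finally show ?thesis
    by (simp add: norm_mult mult.commute)
qed

lemma continuous_on_quotient: "continuous_on (cball 0 1) (\<lambda>z. poly p z / poly q z)"
  using q_nonzero by (intro continuous_intros) auto

lemma tendsto_norm_disk_map: "((\<lambda>z. norm (disk_map (rat_map p q) z)) \<longlongrightarrow> 1) at_circle"
proof (rule Lim_transform_eventually)
  show "((\<lambda>z. norm (poly p z / poly q z)) \<longlongrightarrow> 1) at_circle"
    by (rule tendsto_norm_at_circle[OF continuous_on_quotient])
       (use norm_eq q_nonzero in \<open>auto simp: norm_divide\<close>)
  show "\<forall>\<^sub>F z in at_circle. norm (poly p z / poly q z) = norm (disk_map (rat_map p q) z)"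
    using eventually_at_circle_disk by eventually_elim (simp add: disk_map_eq)
qed

lemma rat_degree_eq: "rat_degree (rat_map p q) = N"
  using rat_degree_rat_map[OF coprime] .

text \<open>Points of the circle map to the circle, so the preimage of a compact subset of the disk
  is also its preimage in the closed disk, hence closed and bounded. Compactness of such preimages
  is enough for properness because the disk is Hausdorff and locally compact.\<close>

lemma proper: "proper_map (top_of_set (ball 0 1)) (top_of_set (ball 0 1)) (disk_map (rat_map p q))"
proof -
  have "compact {z \<in> ball 0 1. disk_map (rat_map p q) z \<in> K}" if K: "compact K" "K \<subseteq> ball 0 1" for K
  proof -
    have "{z \<in> ball 0 1. disk_map (rat_map p q) z \<in> K} = cball 0 1 \<inter> (\<lambda>z. poly p z / poly q z) -` K"
    proof (intro equalityI subsetI)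
      fix z assume "z \<in> cball 0 1 \<inter> (\<lambda>z. poly p z / poly q z) -` K"
      then have z: "norm z \<le> 1" "poly p z / poly q z \<in> K" by auto
      with K have "norm (poly p z / poly q z) < 1" by auto
      then have "norm z \<noteq> 1"
        using norm_eq[of z] q_nonzero[of z] z by (auto simp: norm_divide)
      with z show "z \<in> {z \<in> ball 0 1. disk_map (rat_map p q) z \<in> K}"
        by (auto simp: disk_map_eq)
    qed (auto simp: disk_map_eq)
    moreover have "closed (cball 0 1 \<inter> (\<lambda>z. poly p z / poly q z) -` K)"
      using continuous_on_quotient K by (intro continuous_closed_preimage) (auto simp: compact_imp_closed)
    ultimately show ?thesis
      using compact_Int_closed[of "cball 0 1" "cball 0 1 \<inter> (\<lambda>z. poly p z / poly q z) -` K"]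
      by (simp add: Int_assoc[symmetric])
  qed
  then show ?thesis
    using norm_quotient_less disk_map_holomorphic
    by (intro compact_imp_proper_map locally_compact_imp_k_space Hausdorff_imp_kc_space
          locally_compact_space_open_subset locally_compact_space_euclidean Hausdorff_space_subtopology)
       (auto simp: compactin_subtopology disk_map_eq holomorphic_on_imp_continuous_on)
qed

lemma disk_map_surj: "disk_map (rat_map p q) ` ball 0 1 = ball 0 1"
proof
  show "disk_map (rat_map p q) ` ball 0 1 \<subseteq> ball 0 1"
    using norm_quotient_less by (auto simp: disk_map_eq)
  show "ball 0 1 \<subseteq> disk_map (rat_map p q) ` ball 0 1"
    using fiber_nonempty by (fastforce simp: fiber_def)
qed

lemma blaschke_product_rat_map: "blaschke_product (rat_map p q)"
proof -
  have "rat_map p q ` (Some ` ball 0 1) = Some ` (disk_map (rat_map p q) ` ball 0 1)"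
    by (force simp: image_image disk_map_eq rat_map_disk)
  then show ?thesis
    unfolding blaschke_product_def rational_map_def
    using coprime rat_degree_eq degree_pos proper disk_map_surj by (auto simp del: rat_degree_eq)
qed

end

section \<open>Blaschke products\<close>

text \<open>The points where the modulus is at most \<open>r\<close> form a compact subset of the
  disk, so their own moduli have a maximum below one.\<close>

lemma tendsto_at_circle_of_proper_map:
  assumes "proper_map (top_of_set (ball 0 1)) (top_of_set (ball 0 1)) f"
    and "f ` ball 0 1 \<subseteq> ball (0::complex) 1"
  shows "((\<lambda>z. norm (f z)) \<longlongrightarrow> 1) at_circle"
proof (rule order_tendstoI)
  fix r :: real assume "r < 1"
  have "compactin (top_of_set (ball 0 1)) (cball (0::complex) r)"
    using \<open>r < 1\<close> by (auto simp: compactin_subtopology)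
  then have "compactin (top_of_set (ball 0 1)) {z \<in> ball 0 1. f z \<in> cball 0 r}"
    using compactin_proper_map_preimage[OF assms(1)] by fastforce
  then have K: "compact {z \<in> ball 0 1. f z \<in> cball 0 r}"
    by (simp add: compactin_subtopology)
  \<comment> \<open>The element 0 keeps the set nonempty when no point has modulus of
    \<open>f\<close> at most \<open>r\<close>.\<close>
  define T where "T = insert 0 (norm ` {z \<in> ball 0 1. f z \<in> cball 0 r})"
  have "compact T"
    unfolding T_def by (intro compact_insert compact_continuous_image continuous_intros K)
  then have T: "closed T" "bdd_above T"
    by (simp_all add: compact_imp_closed bounded_imp_bdd_above compact_imp_bounded)
  have "T \<noteq> {}" by (simp add: T_def)
  define s where "s = Sup T"
  have s: "s \<in> T" and le: "\<And>t. t \<in> T \<Longrightarrow> t \<le> s"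
    unfolding s_def using T \<open>T \<noteq> {}\<close> by (auto intro: closed_contains_Sup cSup_upper)
  have "s < 1" using s by (auto simp: T_def)
  moreover have "r < norm (f z)" if "s < norm z" "norm z < 1" for z
  proof (rule ccontr)
    assume "\<not> r < norm (f z)"
    then have "norm z \<le> s" using that by (intro le) (auto simp: T_def)
    with that show False by simp
  qed
  ultimately show "\<forall>\<^sub>F z in at_circle. r < norm (f z)"
    unfolding eventually_at_circle by blast
next
  fix r :: real assume "1 < r"
  show "\<forall>\<^sub>F z in at_circle. norm (f z) < r"
    using eventually_at_circle_disk
    by eventually_elim (use assms(2) \<open>1 < r\<close> in \<open>force simp: image_subset_iff\<close>)
qed

text \<open>Only equality of moduli on the circle needs work. A zero of \<open>q\<close> on the
  circle is not yet excluded, so the radial limits are taken for \<open>p\<close> and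
  \<open>q\<close> separately and not for their quotient.\<close>

lemma blaschke_product_obtain:
  assumes "blaschke_product F"
  obtains p q where "blaschke_quotient p q" "F = rat_map p q"
proof -
  obtain p q where pq: "coprime p q" "F = rat_map p q"
    using assms unfolding blaschke_product_def rational_map_def by blast
  have img: "F ` (Some ` ball 0 1) = Some ` ball 0 1"
    and proper: "proper_map (top_of_set (ball 0 1)) (top_of_set (ball 0 1)) (disk_map F)"
    and deg: "rat_degree F \<ge> 1"
    using assms by (auto simp: blaschke_product_def)
  have disk: "poly q z \<noteq> 0 \<and> norm (poly p z / poly q z) < 1 \<and> disk_map F z = poly p z / poly q z"
    if "norm z < 1" for z
  proof -
    have "F (Some z) \<in> Some ` ball 0 1"
      using that by (subst img[symmetric]) auto
    then show ?thesis
      by (auto simp: pq rat_map_def disk_map_def split: if_splits)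
  qed
  have less: "norm (poly p z) < norm (poly q z)" if "norm z < 1" for z
    using disk[OF that] by (metis divide_less_eq_1_pos norm_divide zero_less_norm_iff)
  have lim: "((\<lambda>z. norm (disk_map F z)) \<longlongrightarrow> 1) at_circle"
    using disk by (intro tendsto_at_circle_of_proper_map[OF proper]) auto
  have "norm (poly p u) = norm (poly q u)" if u: "norm u = 1" for u
  proof -
    have radial: "((\<lambda>t. norm (poly r (of_real t * u))) \<longlongrightarrow> norm (poly r (of_real 1 * u))) (at_left 1)" for r
      by (intro tendsto_intros)
    have norm_radial: "\<forall>\<^sub>F t in at_left (1::real). norm (of_real t * u) = t"
      unfolding eventually_at_left_field using u by (intro exI[of _ 0]) (auto simp: norm_mult)
    have below: "\<forall>\<^sub>F t in at_left (1::real). t < 1"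
      unfolding eventually_at_left_field by (intro exI[of _ 0]) auto
    have "norm (poly p (of_real 1 * u)) \<le> norm (poly q (of_real 1 * u))"
    proof (rule tendsto_le[OF _ radial radial])
      show "\<forall>\<^sub>F t in at_left 1. norm (poly p (of_real t * u)) \<le> norm (poly q (of_real t * u))"
        using norm_radial below by eventually_elim (simp add: less less_imp_le)
    qed simp
    \<comment> \<open>Properness gives modulus above \<open>r\<close> near the circle for each
      \<open>r < 1\<close>; the factor \<open>r\<close> is removed afterwards by letting it approach
      one.\<close>
    moreover have "r * norm (poly q (of_real 1 * u)) \<le> norm (poly p (of_real 1 * u))" if "r < 1" for r
    proof (rule tendsto_le[OF _ radial])
      show "((\<lambda>t. r * norm (poly q (of_real t * u))) \<longlongrightarrow> r * norm (poly q (of_real 1 * u))) (at_left 1)"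
        by (intro tendsto_mult_left radial)
      obtain s where s: "s < 1" "\<And>z. s < norm z \<Longrightarrow> norm z < 1 \<Longrightarrow> r < norm (disk_map F z)"
        using order_tendstoD(1)[OF lim \<open>r < 1\<close>] unfolding eventually_at_circle by blast
      have above: "\<forall>\<^sub>F t in at_left (1::real). s < t"
        unfolding eventually_at_left_field using s by (intro exI[of _ s]) auto
      show "\<forall>\<^sub>F t in at_left 1. r * norm (poly q (of_real t * u)) \<le> norm (poly p (of_real t * u))"
        using norm_radial below above
      proof eventually_elim
        case (elim t)
        then have "norm (of_real t * u) < 1" "s < norm (of_real t * u)" by auto
        then show ?case
          using s(2)[of "of_real t * u"] disk[of "of_real t * u"]
          by (simp add: norm_divide divide_simps less_imp_le split: if_splits)
      qed
    qed simp
    then have "norm (poly q (of_real 1 * u)) \<le> norm (poly p (of_real 1 * u))"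
      by (rule field_le_mult_one_interval)
    ultimately show ?thesis by simp
  qed
  then have "blaschke_quotient p q"
    using pq(1) less deg unfolding pq(2) rat_degree_rat_map[OF pq(1)]
    by unfold_locales auto
  with pq(2) show ?thesis using that by blast
qed

text \<open>A common divisor has no root, so it is constant by the fundamental theorem of
  algebra.\<close>

lemma coprime_complex_polyI:
  fixes p q :: "complex poly"
  assumes "\<And>z. poly p z = 0 \<Longrightarrow> poly q z \<noteq> 0"
  shows "coprime p q"
proof (rule coprimeI)
  fix r assume "r dvd p" "r dvd q"
  then have "poly r z \<noteq> 0" for z
    using assms by (metis dvdE mult_zero_left poly_mult)
  then have "degree r = 0" "r \<noteq> 0"
    using fundamental_theorem_of_algebra[of r] constant_degree[of r] by auto
  then show "is_unit r"
    by (simp add: is_unit_iff_degree)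
qed

lemma norm_prod_list_Moebius_less:
  assumes "xs \<noteq> []" "set xs \<subseteq> ball 0 1" "norm z < 1"
  shows "norm (\<Prod>a\<leftarrow>xs. Moebius_function 0 a z) < 1"
  using assms(1,2)
proof (induction xs)
  case (Cons a xs)
  have "norm (Moebius_function 0 a z) < 1"
    using Cons.prems assms(3) by (intro Moebius_function_norm_lt_1) auto
  moreover have "norm (\<Prod>a\<leftarrow>xs. Moebius_function 0 a z) \<le> 1"
    using Cons by (cases "xs = []") (auto simp: less_imp_le)
  ultimately have "norm (Moebius_function 0 a z) * norm (\<Prod>a\<leftarrow>xs. Moebius_function 0 a z) < 1"
    by (metis mult_left_le norm_ge_zero order_le_less_trans)
  then show ?case by (simp add: norm_mult)
qed auto

lemma norm_prod_list_Moebius_circle: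
  assumes "set xs \<subseteq> ball 0 1" "norm z = 1"
  shows "norm (\<Prod>a\<leftarrow>xs. Moebius_function 0 a z) = 1"
  using assms by (induction xs) (auto simp: norm_mult norm_Moebius_circle)

lemma poly_prod_list_map: "poly (\<Prod>a\<leftarrow>xs. f a) z = (\<Prod>a\<leftarrow>xs. poly (f a) z)"
  by (induction xs) auto

lemma degree_prod_list_linear: "degree (\<Prod>a\<leftarrow>xs. [:- a, 1:]) = length (xs :: complex list)"
proof (induction xs)
  case (Cons x xs)
  have "degree ([:- x, 1:] * (\<Prod>a\<leftarrow>xs. [:- a, 1:])) = degree [:- x, 1:] + degree (\<Prod>a\<leftarrow>xs. [:- a, 1:])"
    by (rule degree_mult_eq) (auto simp: prod_list_zero_iff)
  with Cons show ?case by (simp del: mult_pCons_left)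
qed auto

text \<open>The recognition criterion through which both right factors and the left factor are
  obtained. Boundedness makes the points of \<open>E\<close> removable, the factorization by zeros
  gives an explicit formula, and the formula is rational.\<close>

lemma blaschke_product_extension:
  assumes E: "finite E"
    and hol: "g holomorphic_on ball 0 1 - E"
    and img: "\<And>z. z \<in> ball 0 1 - E \<Longrightarrow> g z \<in> ball 0 1"
    and lim: "((\<lambda>z. norm (g z)) \<longlongrightarrow> 1) at_circle"
  obtains F where "blaschke_product F" "\<And>z. z \<in> ball 0 1 - E \<Longrightarrow> disk_map F z = g z"
proof -
  have [simp]: "ball 0 1 - E \<inter> ball 0 1 = ball 0 1 - E" by auto
  have "\<exists>h. h holomorphic_on ball 0 1 \<and> (\<forall>z\<in>ball 0 1 - E \<inter> ball 0 1. h z = g z)"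
  proof (rule removable_singularities)
    \<comment> \<open>A punctured neighbourhood that misses the other points of \<open>E\<close>
      lies in the domain where \<open>g\<close> is bounded by one.\<close>
    fix z assume "z \<in> E \<inter> ball 0 1"
    have "\<forall>\<^sub>F w in at z. w \<in> ball 0 1 - (E - {z}) - {z}"
      using E \<open>z \<in> E \<inter> ball 0 1\<close> by (intro eventually_at_in_open) (auto intro!: open_Diff finite_imp_closed)
    then have "\<forall>\<^sub>F w in at z. norm (g w) \<le> 1 * norm (1 :: complex)"
      by eventually_elim (use img in \<open>force simp: less_imp_le\<close>)
    then show "g \<in> O[at z](\<lambda>_. 1)"
      by (rule bigoI)
  qed (use E hol in auto)
  then obtain h where h: "h holomorphic_on ball 0 1" and hg: "\<And>z. z \<in> ball 0 1 - E \<Longrightarrow> h z = g z"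
    by auto
  have "((\<lambda>z. norm (h z)) \<longlongrightarrow> 1) at_circle"
  proof (rule Lim_transform_eventually[OF lim])
    show "\<forall>\<^sub>F z in at_circle. norm (g z) = norm (h z)"
      using eventually_at_circle_disk eventually_at_circle_avoid_finite[OF E]
      by eventually_elim (simp add: hg)
  qed
  then obtain c xs where c: "norm c = 1" and xs: "set xs \<subseteq> ball 0 1"
    and h_eq: "\<And>z. z \<in> ball 0 1 \<Longrightarrow> h z = c * (\<Prod>a\<leftarrow>xs. Moebius_function 0 a z)"
    using factorization_by_zeros[OF h] by metis
  \<comment> \<open>Without zeros \<open>h\<close> would be a constant of modulus one, although
    \<open>g\<close> takes values in the open disk.\<close>
  have "xs \<noteq> []"
  proof
    assume "xs = []"
    obtain s where "s < 1" "\<And>z. s < norm z \<Longrightarrow> norm z < 1 \<Longrightarrow> z \<notin> E"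
      using eventually_at_circle_avoid_finite[OF E] unfolding eventually_at_circle by blast
    moreover obtain z :: complex where "s < norm z" "norm z < 1"
      using norm_between[OF \<open>s < 1\<close>] .
    ultimately have "z \<in> ball 0 1 - E" by auto
    then show False
      using h_eq[of z] hg[of z] img[of z] c \<open>xs = []\<close> by auto
  qed
  define p where "p = smult c (\<Prod>a\<leftarrow>xs. [:- a, 1:])"
  define q where "q = (\<Prod>a\<leftarrow>xs. [:1, - cnj a:])"
  have p_eq: "poly p z = c * (\<Prod>a\<leftarrow>xs. Moebius_function 0 a z) * poly q z"
    and q_nz: "poly q z \<noteq> 0" if "norm z \<le> 1" for z
  proof -
    have "(\<Prod>a\<leftarrow>xs. z - a) = (\<Prod>a\<leftarrow>xs. Moebius_function 0 a z) * (\<Prod>a\<leftarrow>xs. 1 - cnj a * z)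
        \<and> (\<Prod>a\<leftarrow>xs. 1 - cnj a * z) \<noteq> 0"
      using xs
    proof (induction xs)
      case (Cons a xs)
      then have "1 - cnj a * z \<noteq> 0"
        using Moebius_denominator_nonzero[of a z] that by auto
      then show ?case
        using Cons by (simp add: Moebius_function_simple)
    qed auto
    moreover have "poly p z = c * (\<Prod>a\<leftarrow>xs. z - a)"
      by (simp add: p_def poly_prod_list_map)
    moreover have "poly q z = (\<Prod>a\<leftarrow>xs. 1 - cnj a * z)"
      by (simp add: q_def poly_prod_list_map mult.commute)
    ultimately show "poly p z = c * (\<Prod>a\<leftarrow>xs. Moebius_function 0 a z) * poly q z" "poly q z \<noteq> 0"
      by auto
  qed
  have "blaschke_quotient p q"
  proof
    show "coprime p q"
    proof (rule coprime_complex_polyI)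
      fix z assume "poly p z = 0"
      then have "\<exists>a\<in>set xs. z = a"
        using c by (auto simp: p_def poly_prod_list_map prod_list_zero_iff)
      then show "poly q z \<noteq> 0"
        using xs by (intro q_nz) auto
    qed
    have "degree p > 0"
      using \<open>xs \<noteq> []\<close> c by (auto simp: p_def degree_prod_list_linear)
    then show "0 < max (degree p) (degree q)" by simp
    show "norm (poly p z) < norm (poly q z)" if "norm z < 1" for z
    proof -
      have "norm (\<Prod>a\<leftarrow>xs. Moebius_function 0 a z) * norm (poly q z) < 1 * norm (poly q z)"
        using that q_nz[of z] by (intro mult_strict_right_mono norm_prod_list_Moebius_less \<open>xs \<noteq> []\<close> xs) auto
      then show ?thesis
        using p_eq[of z] that c by (simp add: norm_mult)
    qed
    show "norm (poly p z) = norm (poly q z)" if "norm z = 1" for z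
      using p_eq[of z] that c norm_prod_list_Moebius_circle[OF xs that] by (simp add: norm_mult)
  qed
  then interpret blaschke_quotient p q .
  have "disk_map (rat_map p q) z = g z" if "z \<in> ball 0 1 - E" for z
    using that disk_map_eq[of z] p_eq[of z] q_nz[of z] h_eq[of z] hg[of z] by auto
  with that[OF blaschke_product_rat_map] show ?thesis .
qed

section \<open>Blaschke products on the disk, freed from their polynomial representation\<close>

context
  fixes F :: "complex option \<Rightarrow> complex option"
  assumes F: "blaschke_product F"
begin

lemma blaschke_holomorphic: "disk_map F holomorphic_on ball 0 1"
  using blaschke_product_obtain[OF F] blaschke_quotient.disk_map_holomorphic by metis

lemma blaschke_in_disk: "z \<in> ball 0 1 \<Longrightarrow> disk_map F z \<in> ball 0 1"
  using blaschke_product_obtain[OF F] blaschke_quotient.disk_map_surj by (metis imageI)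

lemma blaschke_surj: "disk_map F ` ball 0 1 = ball 0 1"
  using blaschke_product_obtain[OF F] blaschke_quotient.disk_map_surj by metis

lemma blaschke_Some:
  assumes "norm z \<le> 1"
  shows "F (Some z) = Some (disk_map F z)"
proof -
  obtain p q where "blaschke_quotient p q" "F = rat_map p q"
    using blaschke_product_obtain[OF F] .
  then show ?thesis
    using assms blaschke_quotient.rat_map_disk blaschke_quotient.disk_map_eq by metis
qed

lemma blaschke_circle:
  assumes "norm z = 1"
  shows "norm (disk_map F z) = 1"
proof -
  obtain p q where pq: "blaschke_quotient p q" "F = rat_map p q"
    using blaschke_product_obtain[OF F] .
  then interpret blaschke_quotient p q by simp
  show ?thesis
    using assms norm_eq[OF assms] q_nonzero[of z] by (simp add: pq(2) disk_map_eq norm_divide)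
qed

lemma blaschke_continuous: "continuous_on (cball 0 1) (disk_map F)"
proof -
  obtain p q where pq: "blaschke_quotient p q" "F = rat_map p q"
    using blaschke_product_obtain[OF F] .
  then interpret blaschke_quotient p q by simp
  show ?thesis
    using continuous_on_quotient by (rule continuous_on_eq) (simp add: pq(2) disk_map_eq)
qed

lemma blaschke_reflect:
  assumes "norm z < 1"
  shows "F (sphere_reflect (Some z)) = sphere_reflect (F (Some z))"
  using blaschke_product_obtain[OF F] blaschke_quotient.rat_map_reflect assms by metis

lemma blaschke_tendsto: "((\<lambda>z. norm (disk_map F z)) \<longlongrightarrow> 1) at_circle"
  using blaschke_product_obtain[OF F] blaschke_quotient.tendsto_norm_disk_map by metis

lemma finite_blaschke_fiber: "w \<in> ball 0 1 \<Longrightarrow> finite (fiber F w)"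
  using blaschke_product_obtain[OF F] blaschke_quotient.finite_fiber by (metis mem_ball_0)

lemma blaschke_fiber_nonempty: "w \<in> ball 0 1 \<Longrightarrow> fiber F w \<noteq> {}"
  using blaschke_product_obtain[OF F] blaschke_quotient.fiber_nonempty by (metis mem_ball_0)

lemma card_blaschke_fiber_le: "w \<in> ball 0 1 \<Longrightarrow> card (fiber F w) \<le> rat_degree F"
  using blaschke_product_obtain[OF F] blaschke_quotient.card_fiber_le blaschke_quotient.rat_degree_eq
  by (metis mem_ball_0)

lemma card_blaschke_fiber:
  "w \<in> ball 0 1 \<Longrightarrow> w \<notin> critical_values F \<Longrightarrow> card (fiber F w) = rat_degree F"
  using blaschke_product_obtain[OF F] blaschke_quotient.card_fiber blaschke_quotient.rat_degree_eq
  by (metis mem_ball_0)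

lemma finite_blaschke_critical_values: "finite (critical_values F)"
  using blaschke_product_obtain[OF F] blaschke_quotient.finite_critical_values by metis

text \<open>
  If \<open>F = p / q\<close>, then up to its leading coefficient \<open>\<Prod>u\<in>fiber F w. x - u\<close> is \<open>p - w q\<close> evaluated at \<open>x\<close>,
  that is \<open>q x * (F x - w)\<close>.
\<close>

lemma blaschke_product_over_fiber:
  assumes x: "x \<in> ball 0 1"
  obtains c where "c > 0"
    "\<And>w. w \<in> ball 0 1 \<Longrightarrow> w \<notin> critical_values F \<Longrightarrow>
       c * norm (disk_map F x - w) \<le> norm (\<Prod>u\<in>fiber F w. x - u)"
proof -
  obtain p q where pq: "blaschke_quotient p q" "F = rat_map p q"
    using blaschke_product_obtain[OF F] .
  then interpret blaschke_quotient p q by simp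
  define M where "M = norm (coeff p N) + norm (coeff q N)"
  have "M > 0"
    using coeff_p_nonzero by (simp add: M_def add_pos_nonneg)
  have qx: "poly q x \<noteq> 0"
    using x q_nonzero by auto
  show ?thesis
  proof
    show "norm (poly q x) / M > 0"
      using qx \<open>M > 0\<close> by simp
    fix w assume w: "w \<in> ball 0 1" "w \<notin> critical_values F"
    let ?P = "norm (\<Prod>u\<in>fiber F w. x - u)"
    have "norm (coeff (p - smult w q) N) \<le> norm (coeff p N) + norm w * norm (coeff q N)"
      using norm_triangle_ineq4[of "coeff p N" "w * coeff q N"] by (simp add: norm_mult)
    also have "\<dots> \<le> M"
      using w(1) mult_right_mono[of "norm w" 1 "norm (coeff q N)"] by (simp add: M_def)
    finally have "?P * norm (coeff (p - smult w q) N) \<le> ?P * M"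
      by (rule mult_left_mono) simp
    moreover have "poly (p - smult w q) x = poly q x * (disk_map F x - w)"
      using qx x disk_map_eq[of x] pq(2) by (simp add: algebra_simps)
    ultimately have "norm (poly q x) * norm (disk_map F x - w) \<le> ?P * M"
      using prod_fiber[of w x] w pq(2) by (simp add: norm_mult)
    then show "norm (poly q x) / M * norm (disk_map F x - w) \<le> ?P"
      using \<open>M > 0\<close> by (simp add: field_simps)
  qed
qed

end

lemma sphere_cases:
  obtains (disk) z where "norm z < 1" "x = Some z"
    | (circle) z where "norm z = 1" "x = Some z"
    | (outside) z where "norm z < 1" "x = sphere_reflect (Some z)"
proof (cases x)
  case None
  then show ?thesis by (intro outside[of 0]) auto
next
  case (Some z)
  consider "norm z < 1" | "norm z = 1" | "norm z > 1" by linarith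
  then show ?thesis
  proof cases
    case 3
    then show ?thesis
      using Some by (intro outside[of "1 / cnj z"]) (auto simp: norm_divide divide_simps)
  qed (use Some disk circle in auto)
qed

text \<open>The identity spreads from the disk to its exterior by reflection and to the circle by continuity.\<close>

lemma blaschke_comp_eqI:
  assumes A: "blaschke_product A" and C: "blaschke_product C" and A1: "blaschke_product A1"
    and eq: "\<And>z. z \<in> ball 0 1 \<Longrightarrow> disk_map A z = disk_map C (disk_map A1 z)"
  shows "A = C \<circ> A1"
proof
  fix x
  have inside: "A (Some z) = C (A1 (Some z))" if "norm z < 1" for z
    using that eq[of z] blaschke_in_disk[OF A1, of z]
    by (simp add: blaschke_Some A A1 C less_imp_le)
  show "A x = (C \<circ> A1) x"
  proof (cases x rule: sphere_cases)
    case (disk z)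
    then show ?thesis using inside by simp
  next
    case (outside z)
    have "A x = sphere_reflect (C (A1 (Some z)))"
      using outside by (simp only: blaschke_reflect[OF A] inside)
    also have "A1 (Some z) = Some (disk_map A1 z)"
      using outside by (simp add: blaschke_Some[OF A1] less_imp_le)
    also have "sphere_reflect (C (Some (disk_map A1 z))) = C (sphere_reflect (Some (disk_map A1 z)))"
      using outside blaschke_in_disk[OF A1, of z] by (intro blaschke_reflect[OF C, symmetric]) auto
    also have "Some (disk_map A1 z) = A1 (Some z)"
      using outside by (simp add: blaschke_Some[OF A1] less_imp_le)
    also have "sphere_reflect (A1 (Some z)) = A1 (sphere_reflect (Some z))"
      using outside by (intro blaschke_reflect[OF A1, symmetric])
    finally show ?thesis
      using outside by simp
  next
    case (circle z)
    have img: "disk_map A1 ` cball 0 1 \<subseteq> cball 0 1"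
    proof
      fix y assume "y \<in> disk_map A1 ` cball 0 1"
      then obtain u where "norm u \<le> 1" "y = disk_map A1 u" by auto
      then show "y \<in> cball 0 1"
        using blaschke_in_disk[OF A1, of u] blaschke_circle[OF A1, of u] by (cases "norm u = 1") auto
    qed
    have "disk_map A z - disk_map C (disk_map A1 z) = 0"
    proof (rule continuous_constant_on_closure[of "ball 0 1" "\<lambda>z. disk_map A z - disk_map C (disk_map A1 z)"])
      show "continuous_on (closure (ball 0 1)) (\<lambda>z. disk_map A z - disk_map C (disk_map A1 z))"
        using img by (auto intro!: continuous_on_diff blaschke_continuous A
            continuous_on_compose2[OF blaschke_continuous[OF C] blaschke_continuous[OF A1]])
    qed (use eq circle in auto)
    then show ?thesis
      using circle blaschke_circle[OF A1, of z] by (simp add: blaschke_Some A A1 C)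
  qed
qed

lemma disk_map_comp:
  assumes "blaschke_product A1" "z \<in> ball 0 1"
  shows "disk_map (C \<circ> A1) z = disk_map C (disk_map A1 z)"
  using assms blaschke_Some[OF assms(1), of z] by (simp add: disk_map_def)

section \<open>Lifting paths\<close>

definition regular_values :: "(complex option \<Rightarrow> complex option) \<Rightarrow> complex set" where
  "regular_values F = ball 0 1 - critical_values F"

text \<open>The action of a path on fibers. The description is meaningful for paths of regular
  values, where lifts exist and \<open>lift_unique\<close> fixes their endpoints.\<close>

definition lift_end ::
  "(complex option \<Rightarrow> complex option) \<Rightarrow> (real \<Rightarrow> complex) \<Rightarrow> complex \<Rightarrow> complex" where
  "lift_end F p w = (THE z. \<exists>g. is_lift F p g \<and> pathstart g = w \<and> pathfinish g = z)"

lemma open_regular_values: "blaschke_product F \<Longrightarrow> open (regular_values F)"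
  unfolding regular_values_def
  by (intro open_Diff finite_imp_closed finite_blaschke_critical_values) auto

context
  fixes F :: "complex option \<Rightarrow> complex option"
  assumes F: "blaschke_product F"
begin

text \<open>Inverting \<open>F\<close> near each point of the fiber over \<open>v0\<close> gives as
  many disjoint branches as the fiber has points. They exhaust the neighbouring fibers because all
  regular fibers have the same cardinality.\<close>

lemma blaschke_local_sections:
  assumes v0: "v0 \<in> regular_values F"
  obtains r s where "r > 0" "ball v0 r \<subseteq> regular_values F"
    "\<And>w. w \<in> fiber F v0 \<Longrightarrow> s w holomorphic_on ball v0 r"
    "\<And>w. w \<in> fiber F v0 \<Longrightarrow> s w v0 = w"
    "\<And>v. v \<in> ball v0 r \<Longrightarrow> bij_betw (\<lambda>w. s w v) (fiber F v0) (fiber F v)"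
proof -
  have v0': "v0 \<in> ball 0 1" "v0 \<notin> critical_values F"
    using v0 by (auto simp: regular_values_def)
  have fin: "finite (fiber F v0)"
    using finite_blaschke_fiber[OF F v0'(1)] .
  have "\<exists>r>0. ball w r \<subseteq> ball 0 1 \<and> inj_on (disk_map F) (ball w r)" if "w \<in> fiber F v0" for w
  proof -
    have "w \<in> ball 0 1" "deriv (disk_map F) w \<noteq> 0"
      using that v0' by (auto simp: fiber_def critical_values_def)
    then show ?thesis
      using has_complex_derivative_locally_injective[OF blaschke_holomorphic[OF F], of w] by force
  qed
  then obtain r1 where r1: "\<And>w. w \<in> fiber F v0 \<Longrightarrow>
      r1 w > 0 \<and> ball w (r1 w) \<subseteq> ball 0 1 \<and> inj_on (disk_map F) (ball w (r1 w))"
    by metis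
  obtain r2 where r2: "\<And>w. r2 w > (0::real)" "\<And>w x. x \<in> fiber F v0 \<Longrightarrow> x \<noteq> w \<Longrightarrow> r2 w \<le> dist w x"
    using finite_set_avoid[OF fin] by metis
  \<comment> \<open>Half the separation \<open>r2\<close> makes the neighbourhoods disjoint, while
    \<open>r1\<close> keeps them in the disk and \<open>F\<close> injective on them.\<close>
  define U where "U = (\<lambda>w. ball w (min (r1 w) (r2 w / 2)))"
  have U: "open (U w)" "w \<in> U w" "U w \<subseteq> ball 0 1" "inj_on (disk_map F) (U w)"
    if "w \<in> fiber F v0" for w
    using r1[OF that] r2(1)[of w] by (auto simp: U_def intro: inj_on_subset)
  have disj: "w = w'" if "w \<in> fiber F v0" "w' \<in> fiber F v0" "z \<in> U w" "z \<in> U w'" for w w' z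
  proof (rule ccontr)
    assume "w \<noteq> w'"
    then have "r2 w \<le> dist w w'" "r2 w' \<le> dist w w'"
      using r2(2)[of w' w] r2(2)[of w w'] that by (auto simp: dist_commute)
    moreover have "dist w w' \<le> dist w z + dist w' z"
      by (rule dist_triangle2)
    moreover have "dist w z < r2 w / 2" "dist w' z < r2 w' / 2"
      using that by (auto simp: U_def)
    ultimately show False by linarith
  qed
  have hol: "disk_map F holomorphic_on U w" if "w \<in> fiber F v0" for w
    using blaschke_holomorphic[OF F] U(3)[OF that] holomorphic_on_subset by blast
  have "\<exists>g. g holomorphic_on (disk_map F ` U w) \<and> (\<forall>z\<in>U w. g (disk_map F z) = z)"
    if "w \<in> fiber F v0" for w
    using holomorphic_has_inverse[OF hol U(1,4)] that by metis
  then obtain s where s: "\<And>w. w \<in> fiber F v0 \<Longrightarrow> s w holomorphic_on (disk_map F ` U w)"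
      "\<And>w z. w \<in> fiber F v0 \<Longrightarrow> z \<in> U w \<Longrightarrow> s w (disk_map F z) = z"
    by metis
  define V where "V = regular_values F \<inter> (\<Inter>w\<in>fiber F v0. disk_map F ` U w)"
  have "open V"
    unfolding V_def
    by (intro open_Int open_INT ballI open_regular_values F fin open_mapping_thm3 hol U)
  moreover have "v0 \<in> V"
    using v0 U(2) by (force simp: V_def fiber_def)
  ultimately obtain r where r: "r > 0" "ball v0 r \<subseteq> V"
    by (meson open_contains_ball)
  have sU: "s w v \<in> U w" "disk_map F (s w v) = v" if "w \<in> fiber F v0" "v \<in> ball v0 r" for w v
  proof -
    have "v \<in> disk_map F ` U w" using that r by (auto simp: V_def)
    then show "s w v \<in> U w" "disk_map F (s w v) = v" using s(2)[OF that(1)] by auto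
  qed
  show ?thesis
  proof
    show "r > 0" "ball v0 r \<subseteq> regular_values F"
      using r by (auto simp: V_def)
    show "s w holomorphic_on ball v0 r" if "w \<in> fiber F v0" for w
      using s(1)[OF that] by (rule holomorphic_on_subset) (use r that in \<open>auto simp: V_def\<close>)
    show "s w v0 = w" if "w \<in> fiber F v0" for w
      using s(2)[OF that U(2)[OF that]] that by (simp add: fiber_def)
    show "bij_betw (\<lambda>w. s w v) (fiber F v0) (fiber F v)" if v: "v \<in> ball v0 r" for v
    proof -
      have inj: "inj_on (\<lambda>w. s w v) (fiber F v0)"
      proof (rule inj_onI)
        fix w w' assume w: "w \<in> fiber F v0" "w' \<in> fiber F v0" and eq: "s w v = s w' v"
        have "s w v \<in> U w'" unfolding eq by (rule sU(1)[OF w(2) v])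
        then show "w = w'" by (rule disj[OF w sU(1)[OF w(1) v]])
      qed
      have v': "v \<in> ball 0 1" "v \<notin> critical_values F"
        using v r by (auto simp: V_def regular_values_def)
      have sub: "(\<lambda>w. s w v) ` fiber F v0 \<subseteq> fiber F v"
        using sU[OF _ v] U(3) by (fastforce simp: fiber_def)
      have "card ((\<lambda>w. s w v) ` fiber F v0) = card (fiber F v)"
        using card_image[OF inj] card_blaschke_fiber[OF F] v0' v' by simp
      then show ?thesis
        using inj sub card_subset_eq[OF finite_blaschke_fiber[OF F v'(1)] sub] by (simp add: bij_betw_def)
    qed
  qed
qed

lemma blaschke_open_sections:
  assumes v0: "v0 \<in> regular_values F"
  obtains r s where "r > 0" "ball v0 r \<subseteq> regular_values F"
    "\<And>w. w \<in> fiber F v0 \<Longrightarrow> s w holomorphic_on ball v0 r"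
    "\<And>w. w \<in> fiber F v0 \<Longrightarrow> s w v0 = w"
    "\<And>w. w \<in> fiber F v0 \<Longrightarrow> open (s w ` ball v0 r)"
    "\<And>w v. w \<in> fiber F v0 \<Longrightarrow> v \<in> ball v0 r \<Longrightarrow> s w v \<in> ball 0 1 \<and> disk_map F (s w v) = v"
    "\<And>v. v \<in> ball v0 r \<Longrightarrow> bij_betw (\<lambda>w. s w v) (fiber F v0) (fiber F v)"
proof -
  obtain r s where rs: "r > 0" "ball v0 r \<subseteq> regular_values F"
    "\<And>w. w \<in> fiber F v0 \<Longrightarrow> s w holomorphic_on ball v0 r"
    "\<And>w. w \<in> fiber F v0 \<Longrightarrow> s w v0 = w"
    "\<And>v. v \<in> ball v0 r \<Longrightarrow> bij_betw (\<lambda>w. s w v) (fiber F v0) (fiber F v)"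
    using blaschke_local_sections[OF v0] by blast
  have sec: "s w v \<in> ball 0 1 \<and> disk_map F (s w v) = v" if "w \<in> fiber F v0" "v \<in> ball v0 r" for w v
    using bij_betwE[OF rs(5)[OF that(2)]] that(1) by (auto simp: fiber_def)
  have "open (s w ` ball v0 r)" if w: "w \<in> fiber F v0" for w
  proof (rule open_mapping_thm3[OF rs(3)[OF w]])
    show "inj_on (s w) (ball v0 r)"
      using sec[OF w] by (metis inj_onI)
  qed auto
  with rs sec that show ?thesis by blast
qed

text \<open>The sheets over a small ball are the images of the local sections, and the sections
  invert \<open>F\<close> on them. The total space omits entire fibers over critical values and not
  only the critical points.\<close>

lemma blaschke_covering_space:
  "covering_space (ball 0 1 \<inter> disk_map F -` regular_values F) (disk_map F) (regular_values F)"
  (is "covering_space ?E _ _")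
proof
  show "continuous_on ?E (disk_map F)"
    using blaschke_continuous[OF F] by (rule continuous_on_subset) auto
  show "disk_map F ` ?E = regular_values F"
  proof
    show "regular_values F \<subseteq> disk_map F ` ?E"
    proof
      fix v assume v: "v \<in> regular_values F"
      then have "v \<in> disk_map F ` ball 0 1"
        by (simp add: blaschke_surj[OF F] regular_values_def)
      with v show "v \<in> disk_map F ` ?E" by auto
    qed
  qed auto
  fix v0 assume v0: "v0 \<in> regular_values F"
  obtain r s where rs: "r > 0" "ball v0 r \<subseteq> regular_values F"
    "\<And>w. w \<in> fiber F v0 \<Longrightarrow> s w holomorphic_on ball v0 r"
    "\<And>w. w \<in> fiber F v0 \<Longrightarrow> s w v0 = w"
    "\<And>w. w \<in> fiber F v0 \<Longrightarrow> open (s w ` ball v0 r)"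
    "\<And>w v. w \<in> fiber F v0 \<Longrightarrow> v \<in> ball v0 r \<Longrightarrow> s w v \<in> ball 0 1 \<and> disk_map F (s w v) = v"
    "\<And>v. v \<in> ball v0 r \<Longrightarrow> bij_betw (\<lambda>w. s w v) (fiber F v0) (fiber F v)"
    using blaschke_open_sections[OF v0] by blast
  have sub: "s w ` ball v0 r \<subseteq> ?E" if "w \<in> fiber F v0" for w
    using rs(2) rs(6)[OF that] by auto
  show "\<exists>T. v0 \<in> T \<and> openin (top_of_set (regular_values F)) T \<and>
      (\<exists>\<V>. \<Union>\<V> = ?E \<inter> disk_map F -` T \<and> (\<forall>u\<in>\<V>. openin (top_of_set ?E) u) \<and>
        pairwise disjnt \<V> \<and> (\<forall>u\<in>\<V>. \<exists>q. homeomorphism u T (disk_map F) q))"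
  proof (intro exI[of _ "ball v0 r"] exI[of _ "(\<lambda>w. s w ` ball v0 r) ` fiber F v0"] conjI ballI)
    show "v0 \<in> ball v0 r" using rs by simp
    show "openin (top_of_set (regular_values F)) (ball v0 r)"
      using rs(2) by (simp add: open_subset)
    show "\<Union> ((\<lambda>w. s w ` ball v0 r) ` fiber F v0) = ?E \<inter> disk_map F -` ball v0 r"
    proof (intro equalityI subsetI)
      fix z assume z: "z \<in> ?E \<inter> disk_map F -` ball v0 r"
      then have v: "z \<in> fiber F (disk_map F z)" "disk_map F z \<in> ball v0 r" by (auto simp: fiber_def)
      then have "z \<in> (\<lambda>w. s w (disk_map F z)) ` fiber F v0"
        using bij_betw_imp_surj_on[OF rs(7)[OF v(2)]] by simp
      then show "z \<in> \<Union> ((\<lambda>w. s w ` ball v0 r) ` fiber F v0)"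
        using v(2) by blast
    next
      fix z assume "z \<in> \<Union> ((\<lambda>w. s w ` ball v0 r) ` fiber F v0)"
      then obtain w v where "w \<in> fiber F v0" "v \<in> ball v0 r" "z = s w v" by auto
      then show "z \<in> ?E \<inter> disk_map F -` ball v0 r"
        using rs(2,6) by auto
    qed
    show "openin (top_of_set ?E) u" if u: "u \<in> (\<lambda>w. s w ` ball v0 r) ` fiber F v0" for u
    proof -
      obtain w where "w \<in> fiber F v0" "u = s w ` ball v0 r" using u by blast
      then show ?thesis using rs(5) sub by (metis open_subset)
    qed
    show "pairwise disjnt ((\<lambda>w. s w ` ball v0 r) ` fiber F v0)"
    proof (rule pairwise_imageI)
      fix w w' assume w: "w \<in> fiber F v0" "w' \<in> fiber F v0" "w \<noteq> w'"
      show "disjnt (s w ` ball v0 r) (s w' ` ball v0 r)"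
        unfolding disjnt_iff
      proof (intro allI notI)
        fix z assume "z \<in> s w ` ball v0 r \<and> z \<in> s w' ` ball v0 r"
        then obtain v v' where v: "v \<in> ball v0 r" "v' \<in> ball v0 r" "s w v = s w' v'" by fast
        then have "v = v'" using rs(6) w by metis
        then show False
          using v w rs(7)[OF v(1)] by (auto simp: bij_betw_def inj_on_def)
      qed
    qed
    fix u assume "u \<in> (\<lambda>w. s w ` ball v0 r) ` fiber F v0"
    then obtain w where w: "w \<in> fiber F v0" "u = s w ` ball v0 r" by auto
    show "\<exists>q. homeomorphism u (ball v0 r) (disk_map F) q"
    proof (intro exI homeomorphismI)
      show "continuous_on u (disk_map F)"
        using blaschke_continuous[OF F] by (rule continuous_on_subset) (use sub w in fastforce)
      show "continuous_on (ball v0 r) (s w)"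
        using rs(3) w holomorphic_on_imp_continuous_on by blast
    qed (use rs(6) w in auto)
  qed
qed

lemma is_lift_in_disk: "is_lift F p g \<Longrightarrow> t \<in> {0..1} \<Longrightarrow> g t \<in> ball 0 1"
  unfolding is_lift_def path_image_def by blast

lemma is_lift_in_cover:
  assumes "is_lift F p g" "path_image p \<subseteq> regular_values F"
  shows "path_image g \<subseteq> ball 0 1 \<inter> disk_map F -` regular_values F"
  using assms unfolding is_lift_def path_image_def by fastforce

lemma lift_exists:
  assumes "path p" "path_image p \<subseteq> regular_values F" "w \<in> fiber F (pathstart p)"
  obtains g where "is_lift F p g" "pathstart g = w"
proof -
  have "w \<in> ball 0 1 \<inter> disk_map F -` regular_values F" "pathstart p = disk_map F w"
    using assms by (auto simp: fiber_def)
  from covering_space_lift_path_strong[OF blaschke_covering_space this(1) assms(1,2) this(2)]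
  obtain g where "path g" "path_image g \<subseteq> ball 0 1 \<inter> disk_map F -` regular_values F"
      "pathstart g = w" "\<And>t. t \<in> {0..1} \<Longrightarrow> disk_map F (g t) = p t"
    by blast
  then show ?thesis
    by (intro that[of g]) (auto simp: is_lift_def)
qed

lemma lift_unique:
  assumes p: "path p" "path_image p \<subseteq> regular_values F"
    and g: "is_lift F p g" and h: "is_lift F p h" and eq: "pathstart g = pathstart h"
  shows "pathfinish g = pathfinish h"
  unfolding pathfinish_def
proof (rule covering_space_lift_unique[OF blaschke_covering_space, of g 0 h "{0..1}" p 1])
  show "g \<in> {0..1} \<rightarrow> ball 0 1 \<inter> disk_map F -` regular_values F"
    using is_lift_in_cover[OF g p(2)] by (auto simp: path_image_def)
  show "h \<in> {0..1} \<rightarrow> ball 0 1 \<inter> disk_map F -` regular_values F"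
    using is_lift_in_cover[OF h p(2)] by (auto simp: path_image_def)
qed (use p g h eq in \<open>auto simp: is_lift_def path_def path_image_def pathstart_def\<close>)

lemma lift_end_eq:
  assumes "path p" "path_image p \<subseteq> regular_values F" "is_lift F p g"
  shows "lift_end F p (pathstart g) = pathfinish g"
  unfolding lift_end_def
proof (rule the_equality)
  show "\<exists>h. is_lift F p h \<and> pathstart h = pathstart g \<and> pathfinish h = pathfinish g"
    using assms(3) by blast
qed (use lift_unique[OF assms(1,2) _ assms(3)] in blast)

lemma lift_end_in_fiber:
  assumes "path p" "path_image p \<subseteq> regular_values F" "w \<in> fiber F (pathstart p)"
  shows "lift_end F p w \<in> fiber F (pathfinish p)"
proof -
  obtain g where g: "is_lift F p g" "pathstart g = w"
    using lift_exists[OF assms] .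
  have "pathfinish g \<in> fiber F (pathfinish p)"
    using g(1) is_lift_in_disk[OF g(1), of 1] by (auto simp: is_lift_def fiber_def pathfinish_def)
  then show ?thesis
    using lift_end_eq[OF assms(1,2) g(1)] g(2) by simp
qed

lemma lift_end_join:
  assumes p: "path p" "path_image p \<subseteq> regular_values F" "w \<in> fiber F (pathstart p)"
    and p': "path p'" "path_image p' \<subseteq> regular_values F" "pathstart p' = pathfinish p"
  shows "lift_end F (p +++ p') w = lift_end F p' (lift_end F p w)"
proof -
  obtain g where g: "is_lift F p g" "pathstart g = w"
    using lift_exists[OF p] .
  then have w': "lift_end F p w = pathfinish g"
    using lift_end_eq[OF p(1,2) g(1)] by simp
  have "pathfinish g \<in> fiber F (pathstart p')"
    using lift_end_in_fiber[OF p] w' p'(3) by simp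
  then obtain h where h: "is_lift F p' h" "pathstart h = pathfinish g"
    using lift_exists[OF p'(1,2)] by metis
  have "is_lift F (p +++ p') (g +++ h)"
    unfolding is_lift_def
  proof (intro conjI ballI)
    show "path (g +++ h)" "path_image (g +++ h) \<subseteq> ball 0 1"
      using g(1) h by (simp_all add: is_lift_def path_image_join)
  qed (use g(1) h in \<open>auto simp: is_lift_def joinpaths_def\<close>)
  moreover have "path_image (p +++ p') \<subseteq> regular_values F"
    using p p' by (simp add: path_image_join)
  ultimately have "lift_end F (p +++ p') (pathstart (g +++ h)) = pathfinish (g +++ h)"
    using p p' by (intro lift_end_eq) auto
  then show ?thesis
    using g(2) h w' lift_end_eq[OF p'(1,2) h(1)] by simp
qed

lemma lift_end_reversepath:
  assumes p: "path p" "path_image p \<subseteq> regular_values F" "w \<in> fiber F (pathstart p)"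
  shows "lift_end F (reversepath p) (lift_end F p w) = w"
proof -
  obtain g where g: "is_lift F p g" "pathstart g = w"
    using lift_exists[OF p] .
  then have w': "lift_end F p w = pathfinish g"
    using lift_end_eq[OF p(1,2) g(1)] by simp
  have "is_lift F (reversepath p) (reversepath g)"
    unfolding is_lift_def
  proof (intro conjI ballI)
    show "path (reversepath g)" "path_image (reversepath g) \<subseteq> ball 0 1"
      using g(1) by (simp_all add: is_lift_def)
  qed (use g(1) in \<open>auto simp: is_lift_def reversepath_def\<close>)
  then have "lift_end F (reversepath p) (pathstart (reversepath g)) = pathfinish (reversepath g)"
    using p by (intro lift_end_eq) auto
  then show ?thesis
    using g(2) w' by simp
qed

lemma lift_end_inj:
  assumes "path p" "path_image p \<subseteq> regular_values F"
    "w \<in> fiber F (pathstart p)" "w' \<in> fiber F (pathstart p)" "lift_end F p w = lift_end F p w'"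
  shows "w = w'"
  by (metis lift_end_reversepath[OF assms(1-3)] lift_end_reversepath[OF assms(1,2,4)] assms(5))

text \<open>Transport along short segments is a local inverse of \<open>F\<close>. This is the
  source of the holomorphic dependence of transported points on the endpoint of the path.\<close>

lemma blaschke_local_lift_end:
  assumes v0: "v0 \<in> regular_values F"
  obtains r where "r > 0" "ball v0 r \<subseteq> regular_values F"
    "\<And>w. w \<in> fiber F v0 \<Longrightarrow> (\<lambda>v. lift_end F (linepath v0 v) w) holomorphic_on ball v0 r"
    "\<And>w. w \<in> fiber F v0 \<Longrightarrow> \<exists>e>0. \<forall>z\<in>ball w e. z \<in> ball 0 1 \<and> disk_map F z \<in> ball v0 r \<and>
        lift_end F (linepath v0 (disk_map F z)) w = z"
proof -
  obtain r s where rs: "r > 0" "ball v0 r \<subseteq> regular_values F"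
    "\<And>w. w \<in> fiber F v0 \<Longrightarrow> s w holomorphic_on ball v0 r"
    "\<And>w. w \<in> fiber F v0 \<Longrightarrow> s w v0 = w"
    "\<And>w. w \<in> fiber F v0 \<Longrightarrow> open (s w ` ball v0 r)"
    "\<And>w v. w \<in> fiber F v0 \<Longrightarrow> v \<in> ball v0 r \<Longrightarrow> s w v \<in> ball 0 1 \<and> disk_map F (s w v) = v"
    "\<And>v. v \<in> ball v0 r \<Longrightarrow> bij_betw (\<lambda>w. s w v) (fiber F v0) (fiber F v)"
    using blaschke_open_sections[OF v0] by blast
  \<comment> \<open>By convexity the segment stays in the ball, where composing it with the section
    yields the lift.\<close>
  have line: "lift_end F (linepath v0 v) w = s w v" if "w \<in> fiber F v0" "v \<in> ball v0 r" for v w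
  proof -
    have seg: "path_image (linepath v0 v) \<subseteq> ball v0 r"
      using that(2) rs(1) by (simp add: closed_segment_subset)
    have seg': "linepath v0 v t \<in> ball v0 r" if "t \<in> {0..1}" for t
      using that seg unfolding path_image_def by blast
    have "is_lift F (linepath v0 v) (s w \<circ> linepath v0 v)"
      unfolding is_lift_def
    proof (intro conjI ballI)
      show "path (s w \<circ> linepath v0 v)"
        using holomorphic_on_imp_continuous_on[OF rs(3)[OF \<open>w \<in> fiber F v0\<close>]] seg
        by (intro path_continuous_image) (auto intro: continuous_on_subset)
      show "path_image (s w \<circ> linepath v0 v) \<subseteq> ball 0 1"
        using rs(6)[OF \<open>w \<in> fiber F v0\<close>] seg by (auto simp: path_image_compose)
    qed (use rs(6)[OF \<open>w \<in> fiber F v0\<close>] seg' in auto)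
    moreover have "path_image (linepath v0 v) \<subseteq> regular_values F"
      using seg rs(2) by blast
    ultimately have "lift_end F (linepath v0 v) (pathstart (s w \<circ> linepath v0 v)) = pathfinish (s w \<circ> linepath v0 v)"
      by (intro lift_end_eq) auto
    then show ?thesis
      using rs(4)[OF \<open>w \<in> fiber F v0\<close>] by (simp add: pathstart_compose pathfinish_compose)
  qed
  show ?thesis
  proof
    show "r > 0" "ball v0 r \<subseteq> regular_values F" using rs(1,2) by simp_all
    show "(\<lambda>v. lift_end F (linepath v0 v) w) holomorphic_on ball v0 r" if "w \<in> fiber F v0" for w
      using rs(3)[OF that] by (rule holomorphic_transform) (simp add: line that)
    fix w assume w: "w \<in> fiber F v0"
    have "w \<in> s w ` ball v0 r"
      using rs(1) rs(4)[OF w] by (metis centre_in_ball imageI)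
    then obtain e where "e > 0" "ball w e \<subseteq> s w ` ball v0 r"
      using rs(5)[OF w] open_contains_ball by blast
    then show "\<exists>e>0. \<forall>z\<in>ball w e. z \<in> ball 0 1 \<and> disk_map F z \<in> ball v0 r \<and>
        lift_end F (linepath v0 (disk_map F z)) w = z"
      using rs(6)[OF w] line[OF w] by (intro exI[of _ e]) fastforce
  qed
qed

lemma lift_end_linepath_refl:
  assumes "v \<in> regular_values F" "w \<in> fiber F v"
  shows "lift_end F (linepath v v) w = w"
proof -
  have "is_lift F (linepath v v) (linepath w w)"
    unfolding is_lift_def
  proof (intro conjI ballI)
    show "disk_map F (linepath w w t) = linepath v v t" for t
      using assms by (simp add: linepath_refl fiber_def)
  qed (use assms in \<open>auto simp: fiber_def\<close>)
  from lift_end_eq[OF _ _ this] show ?thesis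
    using assms by simp
qed

lemma monodromy_lift_end:
  assumes lab: "labelling F v d a" and i: "i \<in> {1..d}"
    and p: "path p" "path_image p \<subseteq> regular_values F" "pathstart p = v" "pathfinish p = v"
  shows "monodromy F d a p i \<in> {1..d}" "a (monodromy F d a p i) = lift_end F p (a i)"
proof -
  have bij: "bij_betw a {1..d} (fiber F v)"
    using lab by (simp add: labelling_def)
  have ai: "a i \<in> fiber F (pathstart p)"
    using bij_betwE[OF bij] i p(3) by blast
  have "lift_end F p (a i) \<in> fiber F v"
    using lift_end_in_fiber[OF p(1,2) ai] p(4) by simp
  then obtain j where j: "j \<in> {1..d}" "a j = lift_end F p (a i)"
    using bij by (metis bij_betw_imp_surj_on imageE)
  have "monodromy F d a p i = j"
    unfolding monodromy_def
  proof (rule the_equality)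
    obtain g where g: "is_lift F p g" "pathstart g = a i"
      using lift_exists[OF p(1,2) ai] .
    then show "j \<in> {1..d} \<and> (\<exists>g. is_lift F p g \<and> pathstart g = a i \<and> pathfinish g = a j)"
      using j lift_end_eq[OF p(1,2) g(1)] by auto
    fix k assume k: "k \<in> {1..d} \<and> (\<exists>g. is_lift F p g \<and> pathstart g = a i \<and> pathfinish g = a k)"
    then have "a k = a j"
      using j lift_end_eq[OF p(1,2)] by metis
    then show "k = j"
      using bij k j by (metis bij_betw_imp_inj_on inj_onD)
  qed
  with j show "monodromy F d a p i \<in> {1..d}" "a (monodromy F d a p i) = lift_end F p (a i)"
    by auto
qed

end

text \<open>The map \<open>G\<close> carries a lift under \<open>F = C \<circ> G\<close> to a lift
  of the same path under \<open>C\<close>.\<close>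

lemma lift_end_comp:
  assumes F: "blaschke_product F" and C: "blaschke_product C" and G: "blaschke_product G"
    and eq: "\<And>z. z \<in> ball 0 1 \<Longrightarrow> disk_map F z = disk_map C (disk_map G z)"
    and p: "path p" "path_image p \<subseteq> regular_values F" "path_image p \<subseteq> regular_values C"
    and w: "w \<in> fiber F (pathstart p)"
  shows "disk_map G (lift_end F p w) = lift_end C p (disk_map G w)"
proof -
  obtain g where g: "is_lift F p g" "pathstart g = w"
    using lift_exists[OF F p(1,2) w] .
  have img: "path_image g \<subseteq> ball 0 1" and "path g"
    using g(1) by (auto simp: is_lift_def)
  have "is_lift C p (disk_map G \<circ> g)"
    unfolding is_lift_def
  proof (intro conjI ballI)
    show "path (disk_map G \<circ> g)"
      using \<open>path g\<close> img blaschke_continuous[OF G]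
      by (intro path_continuous_image) (auto intro!: continuous_on_subset[OF blaschke_continuous[OF G]])
    show "path_image (disk_map G \<circ> g) \<subseteq> ball 0 1"
      using img blaschke_in_disk[OF G] by (auto simp: path_image_compose)
    fix t :: real assume t: "t \<in> {0..1}"
    then have "g t \<in> ball 0 1" by (rule is_lift_in_disk[OF F g(1)])
    then show "disk_map C ((disk_map G \<circ> g) t) = p t"
      using eq[of "g t"] g(1) t by (simp add: is_lift_def)
  qed
  from lift_end_eq[OF C p(1,3) this] show ?thesis
    using g lift_end_eq[OF F p(1,2) g(1)] by (simp add: pathstart_compose pathfinish_compose)
qed

section \<open>Labellings from a common left factor\<close>

lemma simeq_rel_sym: "simeq_rel A B v d a b j k \<Longrightarrow> simeq_rel A B v d a b k j"
  unfolding simeq_rel_def by blast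

lemma sim_rel_sym: "sim_rel A B v d a b j k \<Longrightarrow> sim_rel A B v d a b k j"
  unfolding sim_rel_def
  by (rule sympD[OF symp_rtranclp]) (auto intro: sympI simeq_rel_sym)

lemma admissible_loop_regular:
  assumes "admissible_loop A B v p"
  shows "path p" "path_image p \<subseteq> regular_values A" "path_image p \<subseteq> regular_values B"
    "pathstart p = v" "pathfinish p = v"
  using assms by (auto simp: admissible_loop_def regular_values_def)

text \<open>By the chain rule the derivative of \<open>A\<close> at \<open>z\<close>, which is
  nonzero, is the product of the two.\<close>

lemma critical_points_comp:
  assumes A: "blaschke_product A" and C: "blaschke_product C" and G: "blaschke_product G"
    and eq: "A = C \<circ> G" and v: "v \<in> regular_values A" and z: "z \<in> fiber A v"
  shows "deriv (disk_map C) (disk_map G z) \<noteq> 0" "deriv (disk_map G) z \<noteq> 0"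
proof -
  have z': "z \<in> ball 0 1" "disk_map A z = v"
    using z by (auto simp: fiber_def)
  have G': "(disk_map G has_field_derivative deriv (disk_map G) z) (at z)"
    using blaschke_holomorphic[OF G] z'(1) holomorphic_derivI open_ball by blast
  have C': "(disk_map C has_field_derivative deriv (disk_map C) (disk_map G z)) (at (disk_map G z))"
    using blaschke_holomorphic[OF C] blaschke_in_disk[OF G z'(1)] holomorphic_derivI open_ball by blast
  have "(disk_map C \<circ> disk_map G has_field_derivative
      deriv (disk_map C) (disk_map G z) * deriv (disk_map G) z) (at z)"
    by (rule DERIV_chain[OF C' G'])
  then have "(disk_map A has_field_derivative
      deriv (disk_map C) (disk_map G z) * deriv (disk_map G) z) (at z)"
    by (rule has_field_derivative_transform_within_open[of _ _ _ "ball 0 1"])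
       (use z' in \<open>auto simp: eq disk_map_comp[OF G]\<close>)
  moreover have "deriv (disk_map A) z \<noteq> 0"
    using v z' by (auto simp: regular_values_def critical_values_def)
  ultimately show "deriv (disk_map C) (disk_map G z) \<noteq> 0" "deriv (disk_map G) z \<noteq> 0"
    using DERIV_imp_deriv by (metis mult_zero_left, metis DERIV_imp_deriv mult_zero_right)
qed

lemma regular_values_comp:
  assumes "blaschke_product A" and "blaschke_product C" and G: "blaschke_product G"
    and eq: "A = C \<circ> G"
  shows "regular_values A \<subseteq> regular_values C"
proof
  fix v assume v: "v \<in> regular_values A"
  have "deriv (disk_map C) c \<noteq> 0" if "c \<in> ball 0 1" "disk_map C c = v" for c
  proof -
    obtain z where z: "z \<in> ball 0 1" "c = disk_map G z"
      using blaschke_surj[OF G] \<open>c \<in> ball 0 1\<close> by blast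
    then have "z \<in> fiber A v"
      using that by (simp add: fiber_def eq disk_map_comp[OF G])
    then show ?thesis
      using critical_points_comp(1)[OF assms v] z by blast
  qed
  then show "v \<in> regular_values C"
    using v by (auto simp: regular_values_def critical_values_def)
qed

lemma fiber_comp:
  assumes "blaschke_product G"
  shows "fiber (C \<circ> G) v = (\<Union>c\<in>fiber C v. fiber G c)"
proof (intro equalityI subsetI)
  fix z assume "z \<in> fiber (C \<circ> G) v"
  then have "z \<in> ball 0 1" "disk_map C (disk_map G z) = v"
    using disk_map_comp[OF assms, of z C] by (simp_all add: fiber_def)
  then have "disk_map G z \<in> fiber C v" "z \<in> fiber G (disk_map G z)"
    using blaschke_in_disk[OF assms, of z] by (simp_all add: fiber_def)
  then show "z \<in> (\<Union>c\<in>fiber C v. fiber G c)" by blast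
next
  fix z assume "z \<in> (\<Union>c\<in>fiber C v. fiber G c)"
  then have "z \<in> ball 0 1" "disk_map C (disk_map G z) = v"
    by (auto simp: fiber_def)
  then show "z \<in> fiber (C \<circ> G) v"
    using disk_map_comp[OF assms, of z C] by (simp add: fiber_def)
qed

text \<open>Over a regular value of \<open>A\<close> the fibers of \<open>G\<close> that occur are
  unramified, so each has \<open>rat_degree G\<close> points. Multiplicativity forces the two right
  factors of a common left factor to have equal degree, which allows their fibers to be
  matched.\<close>

lemma card_fiber_comp:
  assumes A: "blaschke_product A" and C: "blaschke_product C" and G: "blaschke_product G"
    and eq: "A = C \<circ> G" and v: "v \<in> regular_values A"
  shows "c \<in> fiber C v \<Longrightarrow> card (fiber G c) = rat_degree G"
    "rat_degree A = rat_degree C * rat_degree G"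
proof -
  show *: "card (fiber G c) = rat_degree G" if c: "c \<in> fiber C v" for c
  proof (rule card_blaschke_fiber[OF G])
    show "c \<in> ball 0 1" using c by (simp add: fiber_def)
    show "c \<notin> critical_values G"
    proof
      assume "c \<in> critical_values G"
      then obtain z where z: "z \<in> ball 0 1" "c = disk_map G z" "deriv (disk_map G) z = 0"
        by (auto simp: critical_values_def)
      then have "z \<in> fiber A v"
        using c by (simp add: fiber_def eq disk_map_comp[OF G])
      then show False
        using critical_points_comp(2)[OF A C G eq v] z by blast
    qed
  qed
  have v': "v \<in> regular_values C"
    using regular_values_comp[OF A C G eq] v by blast
  have "rat_degree A = card (\<Union>c\<in>fiber C v. fiber G c)"
    using card_blaschke_fiber[OF A, of v] v by (simp add: regular_values_def eq fiber_comp[OF G])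
  also have "\<dots> = (\<Sum>c\<in>fiber C v. card (fiber G c))"
  proof (rule card_UN_disjoint)
    show "finite (fiber C v)"
      using v' by (intro finite_blaschke_fiber[OF C]) (simp add: regular_values_def)
    show "\<forall>c\<in>fiber C v. finite (fiber G c)"
      using finite_blaschke_fiber[OF G] by (auto simp: fiber_def[of C])
  qed (auto simp: fiber_def)
  also have "\<dots> = rat_degree C * rat_degree G"
    using * card_blaschke_fiber[OF C, of v] v' by (simp add: regular_values_def)
  finally show "rat_degree A = rat_degree C * rat_degree G" .
qed

lemma nontrivial_labelling_of_common_left_factor:
  assumes A: "blaschke_product A" and B: "blaschke_product B"
    and A1: "blaschke_product A1" and B1: "blaschke_product B1" and C: "blaschke_product C"
    and deg: "rat_degree A = d" "rat_degree B = d" "rat_degree C > 1"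
    and eqA: "A = C \<circ> A1" and eqB: "B = C \<circ> B1"
    and vA: "v \<in> regular_values A" and vB: "v \<in> regular_values B"
  obtains a b where "labelling A v d a" "labelling B v d b"
    "\<not> trivial_rel_on d (sim_rel A B v d a b)"
proof -
  have v: "v \<in> ball 0 1" using vA by (simp add: regular_values_def)
  have deg_eq: "rat_degree A1 = rat_degree B1"
    using card_fiber_comp(2)[OF A C A1 eqA vA] card_fiber_comp(2)[OF B C B1 eqB vB] deg by simp
  have "\<exists>h. bij_betw h (fiber A1 c) (fiber B1 c)" if "c \<in> fiber C v" for c
    using card_fiber_comp(1)[OF A C A1 eqA vA that] card_fiber_comp(1)[OF B C B1 eqB vB that] deg_eq that
    by (intro finite_same_card_bij finite_blaschke_fiber[OF A1] finite_blaschke_fiber[OF B1])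
       (auto simp: fiber_def)
  then obtain h where h: "\<And>c. c \<in> fiber C v \<Longrightarrow> bij_betw (h c) (fiber A1 c) (fiber B1 c)"
    by metis
  \<comment> \<open>The bijections between fibers of \<open>A1\<close> and \<open>B1\<close> over
    the same point \<open>c\<close> of the fiber of \<open>C\<close> are glued; labelling
    \<open>B\<close> through \<open>f\<close> makes corresponding points have equal images.\<close>
  define f where "f = (\<lambda>x. h (disk_map A1 x) x)"
  have f: "bij_betw f (fiber A v) (fiber B v)"
  proof -
    have mem: "disk_map A1 x \<in> fiber C v" "x \<in> fiber A1 (disk_map A1 x)" if "x \<in> fiber A v" for x
      using that blaschke_in_disk[OF A1] by (auto simp: fiber_def eqA disk_map_comp[OF A1])
    have img: "f x \<in> fiber B1 (disk_map A1 x)" if "x \<in> fiber A v" for x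
      using bij_betwE[OF h[OF mem(1)[OF that]]] mem(2)[OF that] by (simp add: f_def)
    have "inj_on f (fiber A v)"
    proof (rule inj_onI)
      fix x y assume xy: "x \<in> fiber A v" "y \<in> fiber A v" "f x = f y"
      then have "disk_map A1 x = disk_map A1 y"
        using img[of x] img[of y] by (simp add: fiber_def)
      then show "x = y"
        using xy mem bij_betw_imp_inj_on[OF h[OF mem(1)[OF xy(1)]]] unfolding f_def
        by (metis inj_onD)
    qed
    moreover have "f ` fiber A v \<subseteq> fiber B v"
      unfolding eqB fiber_comp[OF B1] using mem(1) img by blast
    moreover have "card (fiber A v) = card (fiber B v)"
      using card_blaschke_fiber[OF A, of v] card_blaschke_fiber[OF B, of v] vA vB deg
      by (simp add: regular_values_def)
    ultimately show ?thesis
      by (simp add: bij_betw_def card_image card_subset_eq[OF finite_blaschke_fiber[OF B v]])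
  qed
  have f_eq: "disk_map B1 (f x) = disk_map A1 x" if "x \<in> fiber A v" for x
  proof -
    have "disk_map A1 x \<in> fiber C v" "x \<in> fiber A1 (disk_map A1 x)"
      using that blaschke_in_disk[OF A1] by (auto simp: fiber_def eqA disk_map_comp[OF A1])
    then have "f x \<in> fiber B1 (disk_map A1 x)"
      using bij_betwE[OF h] by (simp add: f_def)
    then show ?thesis by (simp add: fiber_def)
  qed
  have "card (fiber A v) = d"
    using card_blaschke_fiber[OF A, of v] vA deg by (simp add: regular_values_def)
  then obtain a where a: "bij_betw a {1..d} (fiber A v)"
    using ex_bij_betw_nat_finite_1[OF finite_blaschke_fiber[OF A v]] by blast
  define b where "b = f \<circ> a"
  have b: "bij_betw b {1..d} (fiber B v)"
    unfolding b_def by (rule bij_betw_trans[OF a f])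
  have ab: "disk_map B1 (b i) = disk_map A1 (a i)" if "i \<in> {1..d}" for i
    using f_eq[of "a i"] bij_betwE[OF a] that by (simp add: b_def)
  have labs: "labelling A v d a" "labelling B v d b"
    using a b by (simp_all add: labelling_def)
  \<comment> \<open>Both sides are the endpoint of the lift under \<open>C\<close> that starts at
    the common image of \<open>a i\<close> and \<open>b i\<close>.\<close>
  have monodromy_eq: "disk_map A1 (a (monodromy B d b p i)) = disk_map A1 (a (monodromy A d a p i))"
    if p: "admissible_loop A B v p" and i: "i \<in> {1..d}" for p i
  proof -
    note p' = admissible_loop_regular[OF p]
    have pC: "path_image p \<subseteq> regular_values C"
      using p'(2) regular_values_comp[OF A C A1 eqA] by blast
    note mA = monodromy_lift_end[OF A labs(1) i p'(1,2,4,5)]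
    note mB = monodromy_lift_end[OF B labs(2) i p'(1,3,4,5)]
    have "disk_map A1 (a (monodromy B d b p i)) = disk_map B1 (lift_end B p (b i))"
      using ab[OF mB(1)] mB(2) by simp
    also have "\<dots> = lift_end C p (disk_map B1 (b i))"
      using bij_betwE[OF b] i p'(4)
      by (intro lift_end_comp[OF B C B1 _ p'(1,3) pC]) (auto simp: eqB disk_map_comp[OF B1])
    also have "disk_map B1 (b i) = disk_map A1 (a i)"
      by (rule ab[OF i])
    also have "lift_end C p (disk_map A1 (a i)) = disk_map A1 (lift_end A p (a i))"
      using bij_betwE[OF a] i p'(4)
      by (intro lift_end_comp[OF A C A1 _ p'(1,2) pC, symmetric]) (auto simp: eqA disk_map_comp[OF A1])
    finally show ?thesis
      using mA(2) by simp
  qed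
  have sim: "disk_map A1 (a j) = disk_map A1 (a k)" if "sim_rel A B v d a b j k" for j k
    using that unfolding sim_rel_def
  proof (induction rule: rtranclp_induct)
    case (step y z)
    then show ?case
      using monodromy_eq unfolding simeq_rel_def by metis
  qed simp
  \<comment> \<open>Each point of the fiber of \<open>C\<close> is the image of some label, so two
    points give two labels that the invariant separates.\<close>
  have "card (fiber C v) > 1"
    using card_blaschke_fiber[OF C, of v] regular_values_comp[OF A C A1 eqA] vA deg(3)
    by (auto simp: regular_values_def)
  then obtain c c' where c: "c \<in> fiber C v" "c' \<in> fiber C v" "c \<noteq> c'"
    by (metis card_le_Suc0_iff_eq finite_blaschke_fiber[OF C v] One_nat_def not_less)
  have "\<exists>j\<in>{1..d}. disk_map A1 (a j) = c" if c: "c \<in> fiber C v" for c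
  proof -
    have "c \<in> disk_map A1 ` ball 0 1"
      using c by (simp add: blaschke_surj[OF A1] fiber_def)
    then obtain z where "z \<in> ball 0 1" "disk_map A1 z = c" by blast
    then have "z \<in> fiber A v"
      using c by (simp add: fiber_def eqA disk_map_comp[OF A1])
    then show ?thesis
      using a \<open>disk_map A1 z = c\<close> by (metis bij_betw_imp_surj_on imageE)
  qed
  then obtain j k where "j \<in> {1..d}" "disk_map A1 (a j) = c" "k \<in> {1..d}" "disk_map A1 (a k) = c'"
    using c by metis
  then have "\<not> trivial_rel_on d (sim_rel A B v d a b)"
    using sim c(3) unfolding trivial_rel_on_def by metis
  with labs that show ?thesis by blast
qed

section \<open>Boundary behaviour and finite exceptional sets\<close>

text \<open>The converse boundary statement: values near the circle are taken only near the circle,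
  since on a smaller closed disk the modulus has a maximum below one.\<close>

lemma blaschke_norm_bound_away:
  assumes F: "blaschke_product F" and "s < 1"
  obtains t where "t < 1" "\<And>z. z \<in> ball 0 1 \<Longrightarrow> t < norm (disk_map F z) \<Longrightarrow> s < norm z"
proof (cases "s \<ge> 0")
  case True
  have "continuous_on (cball 0 s) (\<lambda>z. norm (disk_map F z))"
    using \<open>s < 1\<close> by (intro continuous_on_norm continuous_on_subset[OF blaschke_continuous[OF F]]) auto
  then obtain x where x: "x \<in> cball 0 s" "\<And>z. z \<in> cball 0 s \<Longrightarrow> norm (disk_map F z) \<le> norm (disk_map F x)"
    using continuous_attains_sup[of "cball (0::complex) s" "\<lambda>z. norm (disk_map F z)"] True by auto
  show ?thesis
  proof
    show "norm (disk_map F x) < 1"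
      using blaschke_in_disk[OF F, of x] x(1) \<open>s < 1\<close> by auto
    show "s < norm z" if "z \<in> ball 0 1" "norm (disk_map F x) < norm (disk_map F z)" for z
      using x(2)[of z] that by force
  qed
next
  case False
  then show ?thesis
    by (intro that[of 0]) (auto intro: less_le_trans[of _ 0])
qed

lemma holomorphic_on_locally:
  assumes "\<And>z. z \<in> S \<Longrightarrow> \<exists>U. open U \<and> z \<in> U \<and> f holomorphic_on U"
  shows "f holomorphic_on S"
  unfolding holomorphic_on_def
proof
  fix z assume "z \<in> S"
  then obtain U where "open U" "z \<in> U" "f holomorphic_on U"
    using assms by blast
  then show "f field_differentiable at z within S"
    using holomorphic_on_imp_differentiable_at field_differentiable_at_within by blast
qed

lemma le_off_finite_imp_le:
  fixes f g :: "complex \<Rightarrow> real"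
  assumes "finite E" "continuous_on (ball 0 1) f" "continuous_on (ball 0 1) g"
    and le: "\<And>z. z \<in> ball 0 1 - E \<Longrightarrow> f z \<le> g z"
    and z: "z \<in> ball 0 1"
  shows "f z \<le> g z"
proof (rule tendsto_le)
  show "(f \<longlongrightarrow> f z) (at z)" "(g \<longlongrightarrow> g z) (at z)"
    using assms(2,3) z by (simp_all add: continuous_on_eq_continuous_at isCont_def)
  have "\<forall>\<^sub>F w in at z. w \<in> (ball 0 1 - (E - {z})) - {z}"
    using assms(1) z by (intro eventually_at_in_open) (auto intro!: open_Diff finite_imp_closed)
  then show "\<forall>\<^sub>F w in at z. f w \<le> g w"
    by eventually_elim (use le in auto)
qed auto

lemma holomorphic_eq_off_finite:
  fixes f g :: "complex \<Rightarrow> complex"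
  assumes "finite E" "f holomorphic_on ball 0 1" "g holomorphic_on ball 0 1"
    and eq: "\<And>z. z \<in> ball 0 1 - E \<Longrightarrow> f z = g z"
    and z: "z \<in> ball 0 1"
  shows "f z = g z"
proof -
  have "norm (f z - g z) \<le> 0"
  proof (rule le_off_finite_imp_le[OF assms(1) _ _ _ z])
    show "continuous_on (ball 0 1) (\<lambda>z. norm (f z - g z))"
      using assms(2,3) by (intro continuous_intros holomorphic_on_imp_continuous_on)
  qed (use eq in auto)
  then show ?thesis by simp
qed

text \<open>The difference quotients are compared in the limit. This will show that zeros of
  \<open>A1\<close> are simple.\<close>

lemma norm_deriv_le:
  assumes f: "(f has_field_derivative f') (at z)" and g: "(g has_field_derivative g') (at z)"
    and le: "\<forall>\<^sub>F w in at z. norm (f w - f z) \<le> norm (g w - g z)"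
  shows "norm f' \<le> norm (g' :: complex)"
proof (rule tendsto_le)
  show "((\<lambda>w. norm ((f w - f z) / (w - z))) \<longlongrightarrow> norm f') (at z)"
    using f by (intro tendsto_norm) (simp add: has_field_derivative_iff)
  show "((\<lambda>w. norm ((g w - g z) / (w - z))) \<longlongrightarrow> norm g') (at z)"
    using g by (intro tendsto_norm) (simp add: has_field_derivative_iff)
  show "\<forall>\<^sub>F w in at z. norm ((f w - f z) / (w - z)) \<le> norm ((g w - g z) / (w - z))"
    using le by eventually_elim (simp add: norm_divide divide_right_mono)
qed auto

lemma power_near_1:
  fixes r :: real
  assumes "r < 1"
  obtains s where "0 < s" "s < 1" "r < s ^ n"
proof -
  have "((\<lambda>x::real. x ^ n) \<longlongrightarrow> 1 ^ n) (at_left 1)"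
    by (intro tendsto_intros)
  then have "\<forall>\<^sub>F x in at_left (1::real). r < x ^ n"
    using assms by (intro order_tendstoD(1)) auto
  then obtain b where b: "b < 1" "\<And>y. b < y \<Longrightarrow> y < 1 \<Longrightarrow> r < y ^ n"
    unfolding eventually_at_left_field by blast
  obtain s where "max b 0 < s" "s < 1"
    using dense[of "max b 0" 1] b(1) by auto
  with b that show ?thesis by auto
qed

section \<open>Monodromy classes\<close>

locale labelled_pair =
  fixes A B :: "complex option \<Rightarrow> complex option" and d :: nat and \<zeta> :: complex
    and a b :: "nat \<Rightarrow> complex"
  assumes A: "blaschke_product A" and B: "blaschke_product B"
    and deg: "rat_degree A = d" "rat_degree B = d"
    and regA: "\<zeta> \<in> regular_values A" and regB: "\<zeta> \<in> regular_values B"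
    and labA: "labelling A \<zeta> d a" and labB: "labelling B \<zeta> d b"
begin

abbreviation sim :: "nat \<Rightarrow> nat \<Rightarrow> bool" where
  "sim \<equiv> sim_rel A B \<zeta> d a b"

definition X :: "complex set" where
  "X = regular_values A \<inter> regular_values B"

definition path_from_base :: "(real \<Rightarrow> complex) \<Rightarrow> bool" where
  "path_from_base p \<longleftrightarrow> path p \<and> path_image p \<subseteq> X \<and> pathstart p = \<zeta>"

definition sim_class :: "nat \<Rightarrow> nat set" where
  "sim_class i = {k \<in> {1..d}. sim i k}"

text \<open>Lets one statement cover \<open>A\<close> with \<open>a\<close> and \<open>B\<close>
  with \<open>b\<close>.\<close>

definition labelled :: "(complex option \<Rightarrow> complex option) \<Rightarrow> (nat \<Rightarrow> complex) \<Rightarrow> bool" where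
  "labelled F f \<longleftrightarrow> F = A \<and> f = a \<or> F = B \<and> f = b"

text \<open>Both maps are restricted over the same base \<open>X\<close>, so that a single path can
  be lifted under either.\<close>

definition cover :: "(complex option \<Rightarrow> complex option) \<Rightarrow> complex set" where
  "cover F = ball 0 1 \<inter> disk_map F -` X"

lemma labelled_A: "labelled A a" and labelled_B: "labelled B b"
  by (simp_all add: labelled_def)

lemma labelledD:
  assumes "labelled F f"
  shows "blaschke_product F" "labelling F \<zeta> d f" "X \<subseteq> regular_values F"
  using assms A B labA labB by (auto simp: labelled_def X_def)

lemma base_in_X: "\<zeta> \<in> X"
  using regA regB by (simp add: X_def)

lemma X_disk: "X \<subseteq> ball 0 1"
  by (auto simp: X_def regular_values_def)

lemma open_X: "open X"
  unfolding X_def by (intro open_Int open_regular_values A B)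

lemma finite_disk_minus_X: "finite (ball 0 1 - X)"
proof -
  have "ball 0 1 - X \<subseteq> critical_values A \<union> critical_values B"
    by (auto simp: X_def regular_values_def)
  then show ?thesis
    using finite_blaschke_critical_values A B by (meson finite_UnI finite_subset)
qed

lemma path_connected_X: "path_connected X"
proof -
  have "connected (ball (0::complex) 1 - (ball 0 1 - X))"
    by (intro connected_open_delete_finite finite_disk_minus_X) auto
  moreover have "ball 0 1 - (ball 0 1 - X) = X"
    using X_disk by auto
  ultimately show ?thesis
    using open_X connected_open_path_connected by simp
qed

lemma path_from_base_exists:
  assumes "v \<in> X"
  obtains p where "path_from_base p" "pathfinish p = v"
  using path_connected_X assms base_in_X unfolding path_connected_def path_from_base_def by metis

lemma path_from_baseD:
  assumes "path_from_base p" "labelled F f"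
  shows "path p" "path_image p \<subseteq> regular_values F" "pathstart p = \<zeta>" "path_image p \<subseteq> X"
  using assms labelledD[OF assms(2)] by (auto simp: path_from_base_def)

lemma label_fiber:
  assumes "labelled F f" "i \<in> {1..d}"
  shows "f i \<in> fiber F \<zeta>"
  using labelledD(2)[OF assms(1)] assms(2) by (auto simp: labelling_def bij_betw_def)

lemma label_inj:
  assumes "labelled F f" "i \<in> {1..d}" "j \<in> {1..d}" "f i = f j"
  shows "i = j"
  using labelledD(2)[OF assms(1)] assms(2-) unfolding labelling_def bij_betw_def by (blast dest: inj_onD)

lemma label_exists:
  assumes "labelled F f" "z \<in> fiber F \<zeta>"
  obtains i where "i \<in> {1..d}" "z = f i"
proof -
  have "z \<in> f ` {1..d}"
    using labelledD(2)[OF assms(1)] assms(2) unfolding labelling_def bij_betw_def by blast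
  then show ?thesis using that by blast
qed

lemma lift_end_label_fiber:
  assumes "path_from_base p" "labelled F f" "i \<in> {1..d}"
  shows "lift_end F p (f i) \<in> fiber F (pathfinish p)"
  using path_from_baseD[OF assms(1,2)] label_fiber[OF assms(2,3)]
  by (intro lift_end_in_fiber[OF labelledD(1)[OF assms(2)]]) auto

lemma lift_end_label_cover:
  assumes "path_from_base p" "labelled F f" "i \<in> {1..d}"
  shows "lift_end F p (f i) \<in> cover F"
  using lift_end_label_fiber[OF assms] path_from_baseD(4)[OF assms(1,2)]
    pathfinish_in_path_image[of p] by (auto simp: cover_def fiber_def)

text \<open>Lifting the reversed path from \<open>w\<close> ends in the fiber over the base point
  and finds the label.\<close>

lemma cover_lift_end:
  assumes F: "labelled F f" and w: "w \<in> cover F" and p: "path_from_base p" "pathfinish p = disk_map F w"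
  obtains i where "i \<in> {1..d}" "w = lift_end F p (f i)"
proof -
  note p' = path_from_baseD[OF p(1) F]
  have r: "path (reversepath p)" "path_image (reversepath p) \<subseteq> regular_values F"
    "w \<in> fiber F (pathstart (reversepath p))"
    using p' p(2) w by (auto simp: cover_def fiber_def)
  have "lift_end F (reversepath p) w \<in> fiber F \<zeta>"
    using lift_end_in_fiber[OF labelledD(1)[OF F] r] p'(3) by simp
  then obtain i where "i \<in> {1..d}" "lift_end F (reversepath p) w = f i"
    using label_exists[OF F] by metis
  then show ?thesis
    using lift_end_reversepath[OF labelledD(1)[OF F] r] by (intro that[of i]) simp_all
qed

lemma cover_cases:
  assumes F: "labelled F f" and w: "w \<in> cover F"
  obtains p i where "path_from_base p" "i \<in> {1..d}" "w = lift_end F p (f i)" "pathfinish p = disk_map F w"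
proof -
  have "disk_map F w \<in> X" using w by (simp add: cover_def)
  then obtain p where p: "path_from_base p" "pathfinish p = disk_map F w"
    using path_from_base_exists by blast
  then show ?thesis
    using cover_lift_end[OF F w p] that by metis
qed

lemma finite_disk_minus_cover:
  assumes F: "labelled F f"
  shows "finite (ball 0 1 - cover F)"
proof -
  have "ball 0 1 - cover F \<subseteq> (\<Union>v\<in>ball 0 1 - X. fiber F v)"
    using blaschke_in_disk[OF labelledD(1)[OF F]] by (auto simp: cover_def fiber_def)
  moreover have "finite (\<Union>v\<in>ball 0 1 - X. fiber F v)"
    using finite_disk_minus_X finite_blaschke_fiber[OF labelledD(1)[OF F]] by blast
  ultimately show ?thesis
    by (rule finite_subset)
qed

lemma disk_minus_disk_minus_cover: "ball 0 1 - (ball 0 1 - cover F) = cover F"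
  by (auto simp: cover_def)

lemma admissible_loop_iff: "admissible_loop A B \<zeta> p \<longleftrightarrow> path_from_base p \<and> pathfinish p = \<zeta>"
  unfolding admissible_loop_def path_from_base_def X_def regular_values_def by auto

context
  fixes F f
  assumes F: "labelled F f"
begin

lemma monodromy_label:
  assumes "path_from_base p" "pathfinish p = \<zeta>" "i \<in> {1..d}"
  shows "monodromy F d f p i \<in> {1..d}" "f (monodromy F d f p i) = lift_end F p (f i)"
  using monodromy_lift_end[OF labelledD(1,2)[OF F] assms(3) path_from_baseD(1-3)[OF assms(1) F] assms(2)]
  by simp_all

lemma monodromy_eqI:
  assumes "path_from_base p" "pathfinish p = \<zeta>" "i \<in> {1..d}" "j \<in> {1..d}" "lift_end F p (f i) = f j"
  shows "monodromy F d f p i = j"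
  using monodromy_label[OF assms(1-3)] assms(4,5) label_inj[OF F] by metis

lemma monodromy_join:
  assumes "path_from_base p" "pathfinish p = \<zeta>" "path_from_base p'" "pathfinish p' = \<zeta>" "i \<in> {1..d}"
  shows "monodromy F d f (p +++ p') i = monodromy F d f p' (monodromy F d f p i)"
proof (rule monodromy_eqI)
  note p = path_from_baseD[OF assms(1) F] and p' = path_from_baseD[OF assms(3) F]
  show "path_from_base (p +++ p')" "pathfinish (p +++ p') = \<zeta>"
    using p p' assms(2,4) by (auto simp: path_from_base_def path_image_join)
  have "lift_end F (p +++ p') (f i) = lift_end F p' (lift_end F p (f i))"
    using p p' assms label_fiber[OF F assms(5)]
    by (intro lift_end_join[OF labelledD(1)[OF F]]) auto
  also have "\<dots> = f (monodromy F d f p' (monodromy F d f p i))"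
    using monodromy_label[OF assms(3,4)] monodromy_label[OF assms(1,2,5)] by metis
  finally show "lift_end F (p +++ p') (f i) = f (monodromy F d f p' (monodromy F d f p i))" .
qed (use monodromy_label assms in metis)+

lemma path_from_base_reversepath:
  assumes "path_from_base p" "pathfinish p = \<zeta>"
  shows "path_from_base (reversepath p)" "pathfinish (reversepath p) = \<zeta>"
  using assms by (auto simp: path_from_base_def)

lemma monodromy_reversepath:
  assumes "path_from_base p" "pathfinish p = \<zeta>" "i \<in> {1..d}"
  shows "monodromy F d f (reversepath p) (monodromy F d f p i) = i"
proof (rule monodromy_eqI[OF path_from_base_reversepath[OF assms(1,2)] _ assms(3)])
  show "monodromy F d f p i \<in> {1..d}"
    by (rule monodromy_label[OF assms])
  show "lift_end F (reversepath p) (f (monodromy F d f p i)) = f i"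
    using path_from_baseD[OF assms(1) F] label_fiber[OF F assms(3)] monodromy_label(2)[OF assms]
    by (simp add: lift_end_reversepath[OF labelledD(1)[OF F]])
qed

end

lemma sim_refl: "sim i i"
  and sim_sym: "sim i j \<Longrightarrow> sim j i"
  and sim_trans: "sim i j \<Longrightarrow> sim j k \<Longrightarrow> sim i k"
  by (simp add: sim_rel_def, rule sim_rel_sym, simp_all add: sim_rel_def)

text \<open>For \<open>B\<close> this is a generating pair of the relation, for \<open>A\<close> it
  is reflexivity.\<close>

lemma sim_monodromy:
  assumes "path_from_base p" "pathfinish p = \<zeta>" "i \<in> {1..d}" "labelled F f"
  shows "sim (monodromy F d f p i) (monodromy A d a p i)"
proof -
  have "simeq_rel A B \<zeta> d a b (monodromy B d b p i) (monodromy A d a p i)"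
    using assms(1-3) unfolding simeq_rel_def admissible_loop_iff by blast
  then have "sim (monodromy B d b p i) (monodromy A d a p i)"
    by (simp add: sim_rel_def r_into_rtranclp)
  with assms(4) show ?thesis
    by (auto simp: labelled_def sim_refl)
qed

lemma simeq_monodromy:
  assumes p: "path_from_base p" "pathfinish p = \<zeta>" and "simeq_rel A B \<zeta> d a b j k"
  shows "sim (monodromy A d a p j) (monodromy A d a p k)"
proof -
  \<comment> \<open>Both sides are compared with the monodromies of the concatenated loop \<open>q +++ p\<close> at \<open>i\<close>.\<close>
  have *: "sim (monodromy A d a p (monodromy B d b q i)) (monodromy A d a p (monodromy A d a q i))"
    if q: "path_from_base q" "pathfinish q = \<zeta>" and i: "i \<in> {1..d}" for q i
  proof -
    have qp: "path_from_base (q +++ p)" "pathfinish (q +++ p) = \<zeta>"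
      using q p by (auto simp: path_from_base_def path_image_join)
    have "sim (monodromy A d a p (monodromy B d b q i)) (monodromy B d b p (monodromy B d b q i))"
      using sim_monodromy[OF p monodromy_label(1)[OF labelled_B q i] labelled_B] by (rule sim_sym)
    also have "monodromy B d b p (monodromy B d b q i) = monodromy B d b (q +++ p) i"
      using monodromy_join[OF labelled_B q p i] by simp
    finally have "sim (monodromy A d a p (monodromy B d b q i)) (monodromy A d a (q +++ p) i)"
      using sim_monodromy[OF qp i labelled_B] sim_trans by blast
    then show ?thesis
      using monodromy_join[OF labelled_A q p i] by simp
  qed
  obtain q i where "path_from_base q" "pathfinish q = \<zeta>" "i \<in> {1..d}"
      "monodromy B d b q i = j \<and> monodromy A d a q i = k \<or> monodromy B d b q i = k \<and> monodromy A d a q i = j"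
    using assms(3) unfolding simeq_rel_def admissible_loop_iff by blast
  then show ?thesis
    using * sim_sym by blast
qed

text \<open>The classes are blocks for the monodromy of \<open>A\<close>. The generators only
  compare images of one index, so this rests on the loop concatenation in
  \<open>simeq_monodromy\<close>.\<close>

lemma sim_monodromy_cong:
  assumes p: "path_from_base p" "pathfinish p = \<zeta>" and "sim j k"
  shows "sim (monodromy A d a p j) (monodromy A d a p k)"
  using assms(3) unfolding sim_rel_def
proof (induction rule: rtranclp_induct)
  case (step y z)
  then show ?case
    using simeq_monodromy[OF p] unfolding sim_rel_def by (metis rtranclp_trans)
qed simp

lemma sim_class_self: "i \<in> {1..d} \<Longrightarrow> i \<in> sim_class i"
  by (simp add: sim_class_def sim_refl)

lemma finite_sim_class: "finite (sim_class i)"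
  by (simp add: sim_class_def)

lemma sim_class_subset: "sim_class i \<subseteq> {1..d}"
  by (auto simp: sim_class_def)

lemma sim_class_eq: "k \<in> sim_class i \<Longrightarrow> sim_class k = sim_class i"
  unfolding sim_class_def using sim_trans sim_sym by blast

end

section \<open>The common left factor\<close>

text \<open>Minimality makes every class at least as large as the degree of \<open>A1\<close>, which
  is computed from the class of \<open>j0\<close> alone.\<close>

locale minimal_class = labelled_pair +
  fixes j0 :: nat
  assumes j0: "j0 \<in> {1..d}"
    and card_min: "\<And>i. i \<in> {1..d} \<Longrightarrow> card (sim_class j0) \<le> card (sim_class i)"
begin

abbreviation \<sigma> :: "complex \<Rightarrow> complex" where
  "\<sigma> \<equiv> Moebius_function 0 (a j0)"

text \<open>The lifts are taken under \<open>A\<close> also when the product is used to define a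
  function on the cover of \<open>B\<close>.\<close>

definition class_prod :: "(real \<Rightarrow> complex) \<Rightarrow> nat \<Rightarrow> complex" where
  "class_prod p i = (\<Prod>k\<in>sim_class i. \<sigma> (lift_end A p (a k)))"

text \<open>A point of the cover of \<open>F\<close> is presented by a path and a label;
  \<open>class_prod_eq\<close> shows that the value does not depend on the presentation.\<close>

definition block_fun :: "(complex option \<Rightarrow> complex option) \<Rightarrow> (nat \<Rightarrow> complex) \<Rightarrow> complex \<Rightarrow> complex" where
  "block_fun F f w = (THE y. \<exists>p i. path_from_base p \<and> i \<in> {1..d} \<and> lift_end F p (f i) = w \<and> y = class_prod p i)"

lemma norm_a_j0: "norm (a j0) < 1"
  using label_fiber[OF labelled_A j0] by (simp add: fiber_def)

lemma disk_map_a_j0: "disk_map A (a j0) = \<zeta>"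
  using label_fiber[OF labelled_A j0] by (simp add: fiber_def)

lemma sigma_norm_less: "z \<in> ball 0 1 \<Longrightarrow> norm (\<sigma> z) < 1"
  using norm_a_j0 by (intro Moebius_function_norm_lt_1) auto

text \<open>Two presentations of a point differ by the loop \<open>g\<close> formed from
  \<open>p\<close> and the reversed \<open>q\<close>. Its monodromy under \<open>A\<close> carries
  the class of \<open>i\<close> onto that of \<open>j\<close>, so the two products have the same
  factors in another order.\<close>

lemma class_prod_eq:
  assumes F: "labelled F f" and p: "path_from_base p" and q: "path_from_base q"
    and i: "i \<in> {1..d}" and j: "j \<in> {1..d}"
    and eq: "lift_end F p (f i) = lift_end F q (f j)"
  shows "class_prod p i = class_prod q j"
proof -
  have fin: "pathfinish p = pathfinish q"
    using lift_end_label_fiber[OF p F i] lift_end_label_fiber[OF q F j] eq by (simp add: fiber_def)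
  define g where "g = p +++ reversepath q"
  have g: "path_from_base g" "pathfinish g = \<zeta>"
    using p q fin by (auto simp: path_from_base_def g_def path_image_join)
  note g' = path_from_base_reversepath[OF labelled_A g]
  have lift_g: "lift_end G g (h k) = lift_end G (reversepath q) (lift_end G p (h k))"
    if "labelled G h" "k \<in> {1..d}" for G h k
    unfolding g_def
    using path_from_baseD[OF p that(1)] path_from_baseD[OF q that(1)] label_fiber[OF that] fin
    by (intro lift_end_join[OF labelledD(1)[OF that(1)]]) auto
  have "lift_end F g (f i) = f j"
    using lift_g[OF F i] eq path_from_baseD[OF q F] label_fiber[OF F j]
    by (simp add: lift_end_reversepath[OF labelledD(1)[OF F]])
  then have "monodromy F d f g i = j"
    using monodromy_eqI[OF F g i j] by simp
  \<comment> \<open>For \<open>F = B\<close> the monodromy of \<open>A\<close> need not send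
    \<open>i\<close> to \<open>j\<close>, but its value is equivalent to \<open>j\<close>, and only
    the class matters.\<close>
  then have ij: "sim j (monodromy A d a g i)"
    using sim_monodromy[OF g i F] by simp
  have rev: "monodromy A d a (reversepath g) (monodromy A d a g k) = k"
    "monodromy A d a g (monodromy A d a (reversepath g) k) = k" if "k \<in> {1..d}" for k
    using monodromy_reversepath[OF labelled_A g that] monodromy_reversepath[OF labelled_A g' that]
    by simp_all
  show ?thesis
    unfolding class_prod_def
  \<comment> \<open>The reindexing uses the monodromy of \<open>A\<close> for both choices of
    \<open>F\<close>, because the factors are lifts under \<open>A\<close>.\<close>
  proof (rule prod.reindex_bij_witness[of _ "monodromy A d a (reversepath g)" "monodromy A d a g"])
    fix k assume "k \<in> sim_class i"
    then have k: "k \<in> {1..d}" "sim i k" by (auto simp: sim_class_def)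
    then show "monodromy A d a (reversepath g) (monodromy A d a g k) = k"
      using rev by simp
    show "monodromy A d a g k \<in> sim_class j"
      using k ij sim_monodromy_cong[OF g k(2)] monodromy_label(1)[OF labelled_A g k(1)]
      by (auto simp: sim_class_def intro: sim_trans)
    have "lift_end A q (a (monodromy A d a g k)) = lift_end A q (lift_end A (reversepath q) (lift_end A p (a k)))"
      using monodromy_label(2)[OF labelled_A g k(1)] lift_g[OF labelled_A k(1)] by simp
    also have "\<dots> = lift_end A p (a k)"
      using lift_end_reversepath[OF A, of "reversepath q" "lift_end A p (a k)"]
        path_from_baseD[OF q labelled_A] lift_end_label_fiber[OF p labelled_A k(1)] fin by simp
    finally show "\<sigma> (lift_end A q (a (monodromy A d a g k))) = \<sigma> (lift_end A p (a k))"
      by simp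
  next
    fix k assume "k \<in> sim_class j"
    then have k: "k \<in> {1..d}" "sim j k" by (auto simp: sim_class_def)
    then show "monodromy A d a g (monodromy A d a (reversepath g) k) = k"
      using rev by simp
    have "sim (monodromy A d a g i) k"
      using ij k(2) sim_sym sim_trans by blast
    then have "sim i (monodromy A d a (reversepath g) k)"
      using sim_monodromy_cong[OF g'] rev(1)[OF i] by metis
    then show "monodromy A d a (reversepath g) k \<in> sim_class i"
      using monodromy_label(1)[OF labelled_A g' k(1)] by (simp add: sim_class_def)
  qed
qed

lemma block_fun_lift_end:
  assumes F: "labelled F f" and p: "path_from_base p" and i: "i \<in> {1..d}"
  shows "block_fun F f (lift_end F p (f i)) = class_prod p i"
  unfolding block_fun_def
proof (rule the_equality)
  show "\<exists>q j. path_from_base q \<and> j \<in> {1..d} \<and> lift_end F q (f j) = lift_end F p (f i) \<and> class_prod p i = class_prod q j"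
    using p i by blast
  show "y = class_prod p i"
    if "\<exists>q j. path_from_base q \<and> j \<in> {1..d} \<and> lift_end F q (f j) = lift_end F p (f i) \<and> y = class_prod q j" for y
    using that class_prod_eq[OF F _ p _ i] by blast
qed

lemma lift_end_disk:
  assumes "path_from_base p" "k \<in> {1..d}"
  shows "lift_end A p (a k) \<in> ball 0 1" "disk_map A (lift_end A p (a k)) = pathfinish p"
  using lift_end_label_fiber[OF assms(1) labelled_A assms(2)] by (auto simp: fiber_def)

text \<open>One factor is split off for strictness; the others are bounded by one.\<close>

lemma norm_class_prod_less:
  assumes p: "path_from_base p" and i: "i \<in> {1..d}"
  shows "norm (class_prod p i) < 1"
proof -
  have less: "norm (\<sigma> (lift_end A p (a k))) < 1" if "k \<in> sim_class i" for k
    using that sim_class_subset lift_end_disk(1)[OF p] sigma_norm_less by blast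
  have "norm (class_prod p i) = norm (\<sigma> (lift_end A p (a i))) *
      (\<Prod>k\<in>sim_class i - {i}. norm (\<sigma> (lift_end A p (a k))))"
    unfolding class_prod_def prod_norm[symmetric]
    by (rule prod.remove[OF finite_sim_class sim_class_self[OF i]])
  also have "\<dots> \<le> norm (\<sigma> (lift_end A p (a i))) * 1"
    using less by (intro mult_left_mono prod_le_1) (auto simp: less_imp_le)
  finally show ?thesis
    using less[OF sim_class_self[OF i]] by simp
qed

lemma block_fun_disk:
  assumes F: "labelled F f" and w: "w \<in> cover F"
  shows "block_fun F f w \<in> ball 0 1"
  using cover_cases[OF F w] block_fun_lift_end[OF F] norm_class_prod_less by (metis mem_ball_0)

text \<open>Nearby points are reached by prolonging \<open>p\<close> with a straight segment. Each
  factor then is a local inverse of \<open>A\<close> applied to \<open>F z\<close>, followed by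
  \<open>\<sigma>\<close>.\<close>

lemma block_fun_local:
  assumes F: "labelled F f" and p: "path_from_base p" and i: "i \<in> {1..d}"
  obtains U where "open U" "lift_end F p (f i) \<in> U"
    "block_fun F f holomorphic_on U"
proof -
  define v0 where "v0 = pathfinish p"
  have v0X: "v0 \<in> X"
    using p pathfinish_in_path_image[of p] by (auto simp: path_from_base_def v0_def)
  then have v0A: "v0 \<in> regular_values A" and v0F: "v0 \<in> regular_values F"
    using labelledD(3)[OF F] labelledD(3)[OF labelled_A] by auto
  obtain r where r: "r > 0" "ball v0 r \<subseteq> X"
    using open_X v0X open_contains_ball by blast
  obtain rA where rA: "rA > 0" "\<And>w. w \<in> fiber A v0 \<Longrightarrow> (\<lambda>v. lift_end A (linepath v0 v) w) holomorphic_on ball v0 rA"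
    using blaschke_local_lift_end[OF A v0A] by metis
  define w0 where "w0 = lift_end F p (f i)"
  have w0: "w0 \<in> fiber F v0"
    using lift_end_label_fiber[OF p F i] by (simp add: w0_def v0_def)
  obtain e where e: "e > 0" "\<And>z. z \<in> ball w0 e \<Longrightarrow> z \<in> ball 0 1 \<and> lift_end F (linepath v0 (disk_map F z)) w0 = z"
    using blaschke_local_lift_end[OF labelledD(1)[OF F] v0F] w0 by metis
  \<comment> \<open>Within \<open>r\<close> the segments stay in \<open>X\<close>, within
    \<open>rA\<close> the lifts under \<open>A\<close> depend holomorphically on the endpoint;
    \<open>e\<close> ensures that the lift under \<open>F\<close> returns \<open>z\<close>.\<close>
  define R where "R = min r rA"
  define U where "U = ball w0 e \<inter> (ball 0 1 \<inter> disk_map F -` ball v0 R)"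
  have cont: "continuous_on (ball 0 1) (disk_map F)"
    using blaschke_holomorphic[OF labelledD(1)[OF F]] by (rule holomorphic_on_imp_continuous_on)
  have "open U"
    unfolding U_def by (intro open_Int continuous_open_preimage[OF cont]) auto
  moreover have "w0 \<in> U"
    using w0 e(1) r(1) rA(1) by (auto simp: U_def R_def fiber_def)
  moreover have "block_fun F f holomorphic_on U"
  proof (rule holomorphic_transform)
    show "(\<lambda>z. \<Prod>k\<in>sim_class i. \<sigma> (lift_end A (linepath v0 (disk_map F z)) (lift_end A p (a k)))) holomorphic_on U"
    proof (intro holomorphic_intros)
      fix k assume "k \<in> sim_class i"
      then have k: "k \<in> {1..d}" by (simp add: sim_class_def)
      have wk: "lift_end A p (a k) \<in> fiber A v0"
        using lift_end_label_fiber[OF p labelled_A k] by (simp add: v0_def)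
      have hol: "(\<lambda>z. lift_end A (linepath v0 (disk_map F z)) (lift_end A p (a k))) holomorphic_on U"
      proof (rule holomorphic_on_compose_gen[of "disk_map F" U _ "ball v0 rA", unfolded o_def])
        show "disk_map F holomorphic_on U"
          using blaschke_holomorphic[OF labelledD(1)[OF F]]
          by (rule holomorphic_on_subset) (auto simp: U_def)
        show "(\<lambda>v. lift_end A (linepath v0 v) (lift_end A p (a k))) holomorphic_on ball v0 rA"
          by (rule rA(2)[OF wk])
      qed (auto simp: U_def R_def)
      have "lift_end A (linepath v0 (disk_map F z)) (lift_end A p (a k)) \<in> ball 0 1" if "z \<in> U" for z
      proof -
        have "path_image (linepath v0 (disk_map F z)) \<subseteq> ball v0 r"
          using that r(1) by (auto simp: U_def R_def closed_segment_subset)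
        also have "\<dots> \<subseteq> regular_values A"
          using r(2) labelledD(3)[OF labelled_A] by blast
        finally have "lift_end A (linepath v0 (disk_map F z)) (lift_end A p (a k)) \<in> fiber A (disk_map F z)"
          using lift_end_in_fiber[OF A, of "linepath v0 (disk_map F z)"] wk by simp
        then show ?thesis by (simp add: fiber_def)
      qed
      then show "(\<lambda>z. \<sigma> (lift_end A (linepath v0 (disk_map F z)) (lift_end A p (a k)))) holomorphic_on U"
        using norm_a_j0
        by (intro holomorphic_on_compose_gen[OF hol Moebius_function_holomorphic, unfolded o_def]) auto
    qed
    fix z assume z: "z \<in> U"
    define q where "q = p +++ linepath v0 (disk_map F z)"
    have seg: "path_image (linepath v0 (disk_map F z)) \<subseteq> X"
    proof -
      have "path_image (linepath v0 (disk_map F z)) \<subseteq> ball v0 r"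
        using z r(1) by (auto simp: U_def R_def closed_segment_subset)
      with r(2) show ?thesis by blast
    qed
    have q: "path_from_base q"
      using p seg by (auto simp: path_from_base_def q_def v0_def path_image_join)
    have join: "lift_end G q (h k) = lift_end G (linepath v0 (disk_map F z)) (lift_end G p (h k))"
      if "labelled G h" "k \<in> {1..d}" for G h k
      unfolding q_def using path_from_baseD[OF p that(1)] label_fiber[OF that] seg labelledD(3)[OF that(1)]
      by (intro lift_end_join[OF labelledD(1)[OF that(1)]]) (auto simp: v0_def)
    have "lift_end F q (f i) = z"
      using join[OF F i] e(2)[of z] z by (simp add: w0_def U_def)
    then have "block_fun F f z = class_prod q i"
      using block_fun_lift_end[OF F q i] by simp
    also have "\<dots> = (\<Prod>k\<in>sim_class i. \<sigma> (lift_end A (linepath v0 (disk_map F z)) (lift_end A p (a k))))"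
      unfolding class_prod_def
      by (intro prod.cong refl arg_cong[where f = \<sigma>] join[OF labelled_A]) (auto simp: sim_class_def)
    finally show "(\<Prod>k\<in>sim_class i. \<sigma> (lift_end A (linepath v0 (disk_map F z)) (lift_end A p (a k)))) = block_fun F f z"
      by simp
  qed
  ultimately show ?thesis
    using that[of U] by (simp add: w0_def)
qed

lemma block_fun_holomorphic:
  assumes F: "labelled F f"
  shows "block_fun F f holomorphic_on cover F"
proof (rule holomorphic_on_locally)
  fix w assume "w \<in> cover F"
  then show "\<exists>U. open U \<and> w \<in> U \<and> block_fun F f holomorphic_on U"
    using cover_cases[OF F] block_fun_local[OF F] by metis
qed

text \<open>If \<open>w\<close> is near the circle, so is \<open>F w\<close>, hence so are all
  points of the fiber of \<open>A\<close> over \<open>F w\<close>, and every factor has modulus near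
  one.\<close>

lemma block_fun_tendsto:
  assumes F: "labelled F f"
  shows "((\<lambda>w. norm (block_fun F f w)) \<longlongrightarrow> 1) at_circle"
proof (rule order_tendstoI)
  have cover: "\<forall>\<^sub>F w in at_circle. w \<in> cover F"
    using eventually_at_circle_disk eventually_at_circle_avoid_finite[OF finite_disk_minus_cover[OF F]]
    by eventually_elim auto
  {
    fix r :: real assume "r > 1"
    show "\<forall>\<^sub>F w in at_circle. norm (block_fun F f w) < r"
      using cover by eventually_elim (use block_fun_disk[OF F] \<open>r > 1\<close> in force)
  next
    fix r :: real assume "r < 1"
    \<comment> \<open>A class has at most \<open>d\<close> members, so a bound \<open>s\<close> for
      each factor with \<open>s ^ d > r\<close> suffices for any class.\<close>
    obtain s where s: "0 < s" "s < 1" "r < s ^ d"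
      using power_near_1[OF \<open>r < 1\<close>] .
    obtain t where t: "t < 1" "\<And>z. t < norm z \<Longrightarrow> norm z < 1 \<Longrightarrow> s < norm (\<sigma> z)"
      using order_tendstoD(1)[OF tendsto_norm_Moebius_at_circle[OF norm_a_j0] s(2)]
      unfolding eventually_at_circle by blast
    obtain u where u: "u < 1" "\<And>z. z \<in> ball 0 1 \<Longrightarrow> u < norm (disk_map A z) \<Longrightarrow> t < norm z"
      using blaschke_norm_bound_away[OF A t(1)] by blast
    have "\<forall>\<^sub>F w in at_circle. u < norm (disk_map F w)"
      using order_tendstoD(1)[OF blaschke_tendsto[OF labelledD(1)[OF F]] u(1)] .
    with cover show "\<forall>\<^sub>F w in at_circle. r < norm (block_fun F f w)"
    proof eventually_elim
      case (elim w)
      obtain p i where p: "path_from_base p" "i \<in> {1..d}" "w = lift_end F p (f i)" "pathfinish p = disk_map F w"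
        using cover_cases[OF F elim(1)] .
      have "s < norm (\<sigma> (lift_end A p (a k)))" if "k \<in> sim_class i" for k
      proof -
        have k: "k \<in> {1..d}" using that by (simp add: sim_class_def)
        show ?thesis
          using t(2)[of "lift_end A p (a k)"] u(2)[of "lift_end A p (a k)"] lift_end_disk[OF p(1) k] elim(2) p(4)
          by simp
      qed
      then have "(\<Prod>k\<in>sim_class i. s) \<le> (\<Prod>k\<in>sim_class i. norm (\<sigma> (lift_end A p (a k))))"
        using s(1) by (intro prod_mono) (auto simp: less_imp_le)
      moreover have "s ^ d \<le> s ^ card (sim_class i)"
        using s card_mono[OF _ sim_class_subset[of i]] by (intro power_decreasing) auto
      ultimately show ?case
        using s(3) block_fun_lift_end[OF F p(1,2)] p(3) by (simp add: class_prod_def prod_norm)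
    qed
  }
qed

lemma block_fun_extension:
  assumes F: "labelled F f"
  obtains G where "blaschke_product G" "\<And>w. w \<in> cover F \<Longrightarrow> disk_map G w = block_fun F f w"
  using blaschke_product_extension[OF finite_disk_minus_cover[OF F], of "block_fun F f"]
    block_fun_holomorphic[OF F] block_fun_disk[OF F] block_fun_tendsto[OF F]
  unfolding disk_minus_disk_minus_cover by blast

text \<open>Injectivity comes from reversing lifts, surjectivity from lifting the reversed path from
  a point of the fiber.\<close>

lemma bij_betw_lift_end:
  assumes p: "path_from_base p"
  shows "bij_betw (\<lambda>k. lift_end A p (a k)) {1..d} (fiber A (pathfinish p))"
proof -
  note p' = path_from_baseD[OF p labelled_A]
  have "pathfinish p \<in> X"
    using p'(4) by (metis pathfinish_in_path_image subsetD)
  have "inj_on (\<lambda>k. lift_end A p (a k)) {1..d}"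
  proof (rule inj_onI)
    fix i j assume ij: "i \<in> {1..d}" "j \<in> {1..d}" "lift_end A p (a i) = lift_end A p (a j)"
    have "a i \<in> fiber A (pathstart p)" "a j \<in> fiber A (pathstart p)"
      unfolding p'(3) by (rule label_fiber[OF labelled_A ij(1)], rule label_fiber[OF labelled_A ij(2)])
    then have "a i = a j"
      using ij(3) by (rule lift_end_inj[OF A p'(1,2)])
    then show "i = j"
      by (rule label_inj[OF labelled_A ij(1,2)])
  qed
  moreover have "(\<lambda>k. lift_end A p (a k)) ` {1..d} = fiber A (pathfinish p)"
  proof
    show "(\<lambda>k. lift_end A p (a k)) ` {1..d} \<subseteq> fiber A (pathfinish p)"
      using lift_end_label_fiber[OF p labelled_A] by auto
    show "fiber A (pathfinish p) \<subseteq> (\<lambda>k. lift_end A p (a k)) ` {1..d}"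
    proof
      fix w assume "w \<in> fiber A (pathfinish p)"
      then have "w \<in> cover A" "pathfinish p = disk_map A w"
        using \<open>pathfinish p \<in> X\<close> by (auto simp: fiber_def cover_def)
      then show "w \<in> (\<lambda>k. lift_end A p (a k)) ` {1..d}"
        using cover_lift_end[OF labelled_A _ p] by (metis imageI)
    qed
  qed
  ultimately show ?thesis by (simp add: bij_betw_def)
qed

text \<open>The factors missing from the class have modulus at most one, so the class product
  dominates the product over the whole fiber, which is comparable to \<open>A - \<zeta>\<close> with
  a constant independent of \<open>w\<close>.\<close>

lemma block_fun_lower_bound:
  obtains c where "c > 0" "\<And>w. w \<in> cover A \<Longrightarrow> c * norm (disk_map A w - \<zeta>) \<le> norm (block_fun A a w)"
proof -
  obtain c where c: "c > 0" "\<And>w. w \<in> ball 0 1 \<Longrightarrow> w \<notin> critical_values A \<Longrightarrow>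
       c * norm (disk_map A (a j0) - w) \<le> norm (\<Prod>u\<in>fiber A w. a j0 - u)"
    using blaschke_product_over_fiber[OF A, of "a j0"] norm_a_j0 by auto
  \<comment> \<open>The Moebius denominator is at most 2 in modulus; over the \<open>d\<close>
    points of a fiber this costs the factor \<open>2 ^ d\<close>.\<close>
  have half: "norm (a j0 - u) / 2 \<le> norm (\<sigma> u)" if "u \<in> ball 0 1" for u
  proof -
    have "norm (a j0) * norm u \<le> 1 * 1"
      using that norm_a_j0 by (intro mult_mono) auto
    then have "norm (1 - cnj (a j0) * u) \<le> 2"
      using norm_triangle_ineq4[of 1 "cnj (a j0) * u"] by (simp add: norm_mult)
    moreover have "norm (1 - cnj (a j0) * u) > 0"
      using Moebius_denominator_nonzero[OF norm_a_j0, of u] that by auto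
    ultimately have "norm (u - a j0) / 2 \<le> norm (u - a j0) / norm (1 - cnj (a j0) * u)"
      by (intro divide_left_mono) auto
    then show ?thesis
      by (simp only: Moebius_function_simple norm_divide norm_minus_commute[of "a j0" u])
  qed
  have "c / 2 ^ d * norm (disk_map A w - \<zeta>) \<le> norm (block_fun A a w)" if w: "w \<in> cover A" for w
  proof -
    obtain p i where p: "path_from_base p" "i \<in> {1..d}" "w = lift_end A p (a i)" "pathfinish p = disk_map A w"
      using cover_cases[OF labelled_A w] .
    define v where "v = disk_map A w"
    have v: "v \<in> ball 0 1" "v \<notin> critical_values A"
      using w labelledD(3)[OF labelled_A] by (auto simp: cover_def v_def regular_values_def)
    have bij: "bij_betw (\<lambda>k. lift_end A p (a k)) {1..d} (fiber A v)"
      using bij_betw_lift_end[OF p(1)] p(4) by (simp add: v_def)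
    have "c / 2 ^ d * norm (v - \<zeta>) = c * norm (disk_map A (a j0) - v) / 2 ^ d"
      by (simp add: disk_map_a_j0 norm_minus_commute)
    also have "\<dots> \<le> norm (\<Prod>u\<in>fiber A v. a j0 - u) / 2 ^ d"
      using c(2)[OF v] by (rule divide_right_mono) simp
    also have "norm (\<Prod>u\<in>fiber A v. a j0 - u) / 2 ^ d = (\<Prod>k\<in>{1..d}. norm (a j0 - lift_end A p (a k)) / 2)"
      unfolding prod.reindex_bij_betw[OF bij, symmetric] by (simp add: prod_norm prod_dividef)
    also have "\<dots> \<le> (\<Prod>k\<in>{1..d}. norm (\<sigma> (lift_end A p (a k))))"
      using half lift_end_disk[OF p(1)] by (intro prod_mono) auto
    also have "\<dots> = (\<Prod>k\<in>sim_class i. norm (\<sigma> (lift_end A p (a k)))) *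
        (\<Prod>k\<in>{1..d} - sim_class i. norm (\<sigma> (lift_end A p (a k))))"
      using prod.subset_diff[OF sim_class_subset[of i]] by (simp add: mult.commute)
    also have "\<dots> \<le> (\<Prod>k\<in>sim_class i. norm (\<sigma> (lift_end A p (a k)))) * 1"
      using sigma_norm_less lift_end_disk(1)[OF p(1)]
      by (intro mult_left_mono prod_le_1 prod_nonneg) (auto simp: less_imp_le)
    also have "\<dots> = norm (block_fun A a w)"
      using block_fun_lift_end[OF labelled_A p(1,2)] p(3) by (simp add: class_prod_def prod_norm)
    finally show ?thesis by (simp add: v_def)
  qed
  with c(1) show ?thesis
    by (intro that[of "c / 2 ^ d"]) auto
qed

end

section \<open>The degree of the right factor and the construction of the left factor\<close>

context minimal_class
begin

context
  fixes A1
  assumes A1: "blaschke_product A1"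
    and A1_eq: "\<And>w. w \<in> cover A \<Longrightarrow> disk_map A1 w = block_fun A a w"
begin

lemma A1_lift_end:
  assumes "path_from_base p" "i \<in> {1..d}"
  shows "disk_map A1 (lift_end A p (a i)) = class_prod p i"
  using A1_eq lift_end_label_cover[OF assms(1) labelled_A assms(2)] block_fun_lift_end[OF labelled_A assms]
  by simp

text \<open>The constant path presents the points of the base fiber.\<close>

lemma A1_label:
  assumes i: "i \<in> {1..d}"
  shows "disk_map A1 (a i) = (\<Prod>k\<in>sim_class i. \<sigma> (a k))"
proof -
  have const: "lift_end A (linepath \<zeta> \<zeta>) (a k) = a k" if "k \<in> {1..d}" for k
    using lift_end_linepath_refl[OF A regA] label_fiber[OF labelled_A that] .
  have "path_from_base (linepath \<zeta> \<zeta>)"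
    using base_in_X by (simp add: path_from_base_def)
  then have "disk_map A1 (a i) = class_prod (linepath \<zeta> \<zeta>) i"
    using A1_lift_end i const by metis
  also have "\<dots> = (\<Prod>k\<in>sim_class i. \<sigma> (a k))"
    unfolding class_prod_def
    by (intro prod.cong refl arg_cong[where f = \<sigma>] const) (auto simp: sim_class_def)
  finally show ?thesis .
qed

lemma A1_lower_bound:
  obtains c where "c > 0" "\<And>w. w \<in> ball 0 1 \<Longrightarrow> c * norm (disk_map A w - \<zeta>) \<le> norm (disk_map A1 w)"
proof -
  obtain c where c: "c > 0" "\<And>w. w \<in> cover A \<Longrightarrow> c * norm (disk_map A w - \<zeta>) \<le> norm (block_fun A a w)"
    using block_fun_lower_bound by blast
  have cont: "continuous_on (ball 0 1) (disk_map A)" "continuous_on (ball 0 1) (disk_map A1)"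
    by (simp_all add: holomorphic_on_imp_continuous_on blaschke_holomorphic A A1)
  have "c * norm (disk_map A w - \<zeta>) \<le> norm (disk_map A1 w)" if w: "w \<in> ball 0 1" for w
  proof (rule le_off_finite_imp_le[OF finite_disk_minus_cover[OF labelled_A] _ _ _ w])
    show "continuous_on (ball 0 1) (\<lambda>w. c * norm (disk_map A w - \<zeta>))"
      "continuous_on (ball 0 1) (\<lambda>w. norm (disk_map A1 w))"
      by (intro continuous_intros cont)+
  qed (use c(2) A1_eq in auto)
  with c(1) that show ?thesis by blast
qed

text \<open>The lower bound places every zero in the fiber of \<open>A\<close> over
  \<open>\<zeta>\<close>; there the product vanishes exactly if \<open>j0\<close> belongs to the
  class.\<close>

lemma fiber_A1_0: "fiber A1 0 = a ` sim_class j0"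
proof (intro equalityI subsetI)
  fix w assume w: "w \<in> fiber A1 0"
  then have w': "w \<in> ball 0 1" "disk_map A1 w = 0" by (simp_all add: fiber_def)
  obtain c where "c > 0" "c * norm (disk_map A w - \<zeta>) \<le> norm (disk_map A1 w)"
    using A1_lower_bound w'(1) by blast
  then have "disk_map A w = \<zeta>"
    using w'(2) by (simp add: mult_le_0_iff)
  with w'(1) have "w \<in> fiber A \<zeta>" by (simp add: fiber_def)
  then obtain i where i: "i \<in> {1..d}" "w = a i"
    using label_exists[OF labelled_A] by metis
  then have "(\<Prod>k\<in>sim_class i. \<sigma> (a k)) = 0"
    using A1_label w by (simp add: fiber_def)
  then obtain k where k: "k \<in> sim_class i" "\<sigma> (a k) = 0"
    using finite_sim_class by (auto simp: prod_zero_iff)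
  then have "k \<in> {1..d}" by (simp add: sim_class_def)
  then have "a k = a j0"
    using k(2) Moebius_function_eq_0_iff[OF norm_a_j0, of "a k"] label_fiber[OF labelled_A]
    by (simp add: fiber_def)
  then have "k = j0"
    using label_inj[OF labelled_A \<open>k \<in> {1..d}\<close> j0] by simp
  then show "w \<in> a ` sim_class j0"
    using k(1) i sim_sym by (auto simp: sim_class_def)
next
  fix w assume "w \<in> a ` sim_class j0"
  then obtain i where i: "i \<in> sim_class j0" "w = a i" by auto
  then have i': "i \<in> {1..d}" "sim_class i = sim_class j0"
    using sim_class_eq by (auto simp: sim_class_def)
  have "(\<Prod>k\<in>sim_class j0. \<sigma> (a k)) = 0"
    using sim_class_self[OF j0] by (intro prod_zero finite_sim_class bexI[of _ j0]) (simp_all add: Moebius_function_eq_zero)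
  then show "w \<in> fiber A1 0"
    using A1_label[OF i'(1)] label_fiber[OF labelled_A i'(1)] i i' by (simp add: fiber_def)
qed

text \<open>At a zero, \<open>A - \<zeta>\<close> vanishes too and is dominated by
  \<open>A1\<close>, so a vanishing derivative of \<open>A1\<close> would make
  \<open>\<zeta>\<close> a critical value of \<open>A\<close>.\<close>

lemma zero_not_critical_A1: "0 \<notin> critical_values A1"
proof
  assume "0 \<in> critical_values A1"
  then obtain w where w: "w \<in> ball 0 1" "disk_map A1 w = 0" "deriv (disk_map A1) w = 0"
    by (auto simp: critical_values_def)
  obtain c where c: "c > 0" "\<And>w. w \<in> ball 0 1 \<Longrightarrow> c * norm (disk_map A w - \<zeta>) \<le> norm (disk_map A1 w)"
    using A1_lower_bound by blast
  have Aw: "disk_map A w = \<zeta>"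
    using c(1) c(2)[OF w(1)] w(2) by (simp add: mult_le_0_iff)
  have "norm (of_real c * deriv (disk_map A) w) \<le> norm (deriv (disk_map A1) w)"
  proof (rule norm_deriv_le)
    show "((\<lambda>z. of_real c * disk_map A z) has_field_derivative of_real c * deriv (disk_map A) w) (at w)"
      using holomorphic_derivI[OF blaschke_holomorphic[OF A] _ w(1)] by (intro DERIV_cmult) auto
    show "(disk_map A1 has_field_derivative deriv (disk_map A1) w) (at w)"
      using holomorphic_derivI[OF blaschke_holomorphic[OF A1] _ w(1)] by auto
    have "\<forall>\<^sub>F z in at w. z \<in> ball 0 1"
      using w(1) by (intro eventually_at_in_open') auto
    then show "\<forall>\<^sub>F z in at w. norm (of_real c * disk_map A z - of_real c * disk_map A w)
        \<le> norm (disk_map A1 z - disk_map A1 w)"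
    proof eventually_elim
      case (elim z)
      have "norm (of_real c * disk_map A z - of_real c * \<zeta>) = c * norm (disk_map A z - \<zeta>)"
        using c(1) by (simp add: norm_mult flip: right_diff_distrib)
      then show ?case
        using c(2)[OF elim] w(2) Aw by simp
    qed
  qed
  then have "deriv (disk_map A) w = 0"
    using w(3) c(1) by simp
  then show False
    using regA w(1) Aw by (auto simp: regular_values_def critical_values_def)
qed

lemma rat_degree_A1: "rat_degree A1 = card (sim_class j0)"
proof -
  have "rat_degree A1 = card (fiber A1 0)"
    using card_blaschke_fiber[OF A1 _ zero_not_critical_A1] by simp
  also have "\<dots> = card (sim_class j0)"
    unfolding fiber_A1_0
    by (rule card_image) (meson inj_onI label_inj[OF labelled_A] sim_class_subset subsetD)
  finally show ?thesis .
qed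

text \<open>The transported class through \<open>w\<close> lies in the fiber of \<open>A1\<close>
  and has at least \<open>rat_degree A1\<close> points, so it is the whole fiber; all its points lie
  over the endpoint of one path. The hypothesis \<open>good\<close> places \<open>w\<close> in the
  cover.\<close>

lemma A1_fiber_const:
  assumes w: "w \<in> ball 0 1" and z: "z \<in> ball 0 1" and eq: "disk_map A1 z = disk_map A1 w"
    and good: "disk_map A1 w \<notin> disk_map A1 ` (ball 0 1 - cover A)"
  shows "disk_map A z = disk_map A w"
proof -
  have wc: "w \<in> cover A" using w good by blast
  obtain p i where p: "path_from_base p" "i \<in> {1..d}" "w = lift_end A p (a i)" "pathfinish p = disk_map A w"
    using cover_cases[OF labelled_A wc] .
  let ?S = "(\<lambda>k. lift_end A p (a k)) ` sim_class i"
  have sub: "?S \<subseteq> fiber A1 (disk_map A1 w)"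
  proof
    fix u assume "u \<in> ?S"
    then obtain k where k: "k \<in> sim_class i" "u = lift_end A p (a k)" by auto
    then have k': "k \<in> {1..d}" "sim_class k = sim_class i"
      using sim_class_eq by (auto simp: sim_class_def)
    then have "disk_map A1 u = disk_map A1 w"
      using A1_lift_end[OF p(1)] k(2) p(2,3) by (simp add: class_prod_def)
    then show "u \<in> fiber A1 (disk_map A1 w)"
      using k k' lift_end_disk[OF p(1)] by (simp add: fiber_def)
  qed
  have disk: "disk_map A1 w \<in> ball 0 1"
    using blaschke_in_disk[OF A1 w] .
  have "inj_on (\<lambda>k. lift_end A p (a k)) (sim_class i)"
    using bij_betw_imp_inj_on[OF bij_betw_lift_end[OF p(1)]] sim_class_subset by (rule inj_on_subset)
  then have "card ?S = card (sim_class i)"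
    by (rule card_image)
  then have "card (fiber A1 (disk_map A1 w)) \<le> card ?S"
    using card_blaschke_fiber_le[OF A1 disk] rat_degree_A1 card_min[OF p(2)] by simp
  then have "?S = fiber A1 (disk_map A1 w)"
    using card_seteq[OF finite_blaschke_fiber[OF A1 disk] sub] by simp
  moreover have "z \<in> fiber A1 (disk_map A1 w)"
    using z eq by (simp add: fiber_def)
  ultimately obtain k where "k \<in> sim_class i" "z = lift_end A p (a k)"
    by blast
  then show ?thesis
    using lift_end_disk(2)[OF p(1), of k] p(4) by (simp add: sim_class_def)
qed

text \<open>The map \<open>C\<close> is \<open>A\<close> composed with an inverse branch of
  \<open>A1\<close>; any branch will do because \<open>A\<close> is constant on the fibers of
  \<open>A1\<close> outside \<open>E\<close>.\<close>

lemma left_factor_exists: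
  obtains C E where "blaschke_product C" "finite E"
    "\<And>w. w \<in> cover A \<Longrightarrow> disk_map A1 w \<notin> E \<Longrightarrow> disk_map C (disk_map A1 w) = disk_map A w"
proof -
  \<comment> \<open>The first part ensures constancy on fibers, the second the existence of local
    sections of \<open>A1\<close>.\<close>
  define E where "E = disk_map A1 ` (ball 0 1 - cover A) \<union> critical_values A1"
  have E: "finite E"
    using finite_disk_minus_cover[OF labelled_A] finite_blaschke_critical_values[OF A1]
    by (simp add: E_def)
  define g where "g c = disk_map A (SOME z. z \<in> fiber A1 c)" for c
  have g_eq: "g c = disk_map A z" if "c \<in> ball 0 1 - E" "z \<in> fiber A1 c" for c z
  proof -
    have "(SOME z. z \<in> fiber A1 c) \<in> fiber A1 c"
      using that(2) by (rule someI)
    then show ?thesis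
      unfolding g_def using that by (intro A1_fiber_const) (auto simp: fiber_def E_def)
  qed
  have ex: "\<exists>z. z \<in> fiber A1 c" if "c \<in> ball 0 1 - E" for c
    using blaschke_fiber_nonempty[OF A1, of c] that by auto
  have "g holomorphic_on ball 0 1 - E"
  proof (rule holomorphic_on_locally)
    fix c assume c: "c \<in> ball 0 1 - E"
    then have "c \<in> regular_values A1" by (simp add: regular_values_def E_def)
    then obtain r s where rs: "r > 0" "ball c r \<subseteq> regular_values A1"
      "\<And>w. w \<in> fiber A1 c \<Longrightarrow> s w holomorphic_on ball c r"
      "\<And>w. w \<in> fiber A1 c \<Longrightarrow> s w c = w"
      "\<And>v. v \<in> ball c r \<Longrightarrow> bij_betw (\<lambda>w. s w v) (fiber A1 c) (fiber A1 v)"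
      using blaschke_local_sections[OF A1] by blast
    obtain w where w: "w \<in> fiber A1 c" using ex[OF c] by blast
    have sec: "s w v \<in> fiber A1 v" if "v \<in> ball c r" for v
      using bij_betwE[OF rs(5)[OF that]] w by blast
    have "g holomorphic_on ball c r \<inter> (ball 0 1 - E)"
    proof (rule holomorphic_transform)
      show "(\<lambda>v. disk_map A (s w v)) holomorphic_on ball c r \<inter> (ball 0 1 - E)"
      proof (rule holomorphic_on_compose_gen[OF _ blaschke_holomorphic[OF A], unfolded o_def])
        show "s w holomorphic_on ball c r \<inter> (ball 0 1 - E)"
          using rs(3)[OF w] by (rule holomorphic_on_subset) auto
      qed (use sec in \<open>auto simp: fiber_def\<close>)
      fix v assume v: "v \<in> ball c r \<inter> (ball 0 1 - E)"
      then show "disk_map A (s w v) = g v"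
        using g_eq[of v "s w v"] sec[of v] by simp
    qed
    moreover have "open (ball c r \<inter> (ball 0 1 - E))"
      using E by (intro open_Int open_Diff finite_imp_closed) auto
    ultimately show "\<exists>U. open U \<and> c \<in> U \<and> g holomorphic_on U"
      using c rs(1) by (intro exI[of _ "ball c r \<inter> (ball 0 1 - E)"]) auto
  qed
  moreover have img: "g c \<in> ball 0 1" if "c \<in> ball 0 1 - E" for c
    using ex[OF that] g_eq[OF that] blaschke_in_disk[OF A] by (auto simp: fiber_def)
  moreover have "((\<lambda>c. norm (g c)) \<longlongrightarrow> 1) at_circle"
  proof (rule order_tendstoI)
    have dom: "\<forall>\<^sub>F c in at_circle. c \<in> ball 0 1 - E"
      using eventually_at_circle_disk eventually_at_circle_avoid_finite[OF E] by eventually_elim auto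
    {
      fix r :: real assume "r > 1"
      show "\<forall>\<^sub>F c in at_circle. norm (g c) < r"
        using dom by eventually_elim (use img \<open>r > 1\<close> in force)
    next
      fix r :: real assume "r < 1"
      obtain s where s: "s < 1" "\<And>z. s < norm z \<Longrightarrow> norm z < 1 \<Longrightarrow> r < norm (disk_map A z)"
        using order_tendstoD(1)[OF blaschke_tendsto[OF A] \<open>r < 1\<close>] unfolding eventually_at_circle by blast
      \<comment> \<open>If \<open>c\<close> is near the circle, its preimages under
        \<open>A1\<close> are near the circle, and there \<open>A\<close> has modulus near
        one.\<close>
      obtain t where t: "t < 1" "\<And>z. z \<in> ball 0 1 \<Longrightarrow> t < norm (disk_map A1 z) \<Longrightarrow> s < norm z"
        using blaschke_norm_bound_away[OF A1 s(1)] by blast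
      have "\<forall>\<^sub>F c in at_circle. t < norm c"
        unfolding eventually_at_circle using t(1) by blast
      with dom show "\<forall>\<^sub>F c in at_circle. r < norm (g c)"
      proof eventually_elim
        case (elim c)
        obtain z where z: "z \<in> fiber A1 c" using ex[OF elim(1)] by blast
        then show ?case
          using g_eq[OF elim(1) z] s(2)[of z] t(2)[of z] elim(2) by (simp add: fiber_def)
      qed
    }
  qed
  ultimately obtain C where C: "blaschke_product C" "\<And>c. c \<in> ball 0 1 - E \<Longrightarrow> disk_map C c = g c"
    using blaschke_product_extension[OF E] by blast
  have "disk_map C (disk_map A1 w) = disk_map A w" if w: "w \<in> cover A" "disk_map A1 w \<notin> E" for w
  proof -
    have w': "w \<in> ball 0 1" using w(1) by (simp add: cover_def)
    then have "disk_map A1 w \<in> ball 0 1 - E"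
      using blaschke_in_disk[OF A1] w(2) by blast
    then show ?thesis
      using C(2) g_eq[of "disk_map A1 w" w] w' by (simp add: fiber_def)
  qed
  with C(1) E that show ?thesis by blast
qed

text \<open>At the lift of a path under \<open>F\<close>, \<open>G\<close> has the value that
  \<open>A1\<close> has at the lift under \<open>A\<close> with the same label, and both lifts lie
  over the same endpoint. The relation between \<open>C\<close>, \<open>A1\<close> and
  \<open>A\<close> thus carries over to \<open>F\<close>.\<close>

lemma factor_through_blocks:
  assumes C: "blaschke_product C" "finite E"
    "\<And>w. w \<in> cover A \<Longrightarrow> disk_map A1 w \<notin> E \<Longrightarrow> disk_map C (disk_map A1 w) = disk_map A w"
    and F: "labelled F f"
    and G: "blaschke_product G" "\<And>w. w \<in> cover F \<Longrightarrow> disk_map G w = block_fun F f w"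
  shows "F = C \<circ> G"
proof (rule blaschke_comp_eqI[OF labelledD(1)[OF F] C(1) G(1)])
  fix z :: complex assume z: "z \<in> ball 0 1"
  \<comment> \<open>Finite because fibers of \<open>G\<close> are finite; the identity then extends
    by continuity.\<close>
  let ?E = "(ball 0 1 - cover F) \<union> (\<Union>c\<in>E \<inter> ball 0 1. fiber G c)"
  show "disk_map F z = disk_map C (disk_map G z)"
  proof (rule holomorphic_eq_off_finite[OF _ blaschke_holomorphic[OF labelledD(1)[OF F]] _ _ z])
    show "finite ?E"
      using finite_disk_minus_cover[OF F] C(2) finite_blaschke_fiber[OF G(1)] by auto
    show "(\<lambda>z. disk_map C (disk_map G z)) holomorphic_on ball 0 1"
      using blaschke_in_disk[OF G(1)]
      by (intro holomorphic_on_compose_gen[OF blaschke_holomorphic[OF G(1)] blaschke_holomorphic[OF C(1)], unfolded o_def]) auto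
    fix w assume "w \<in> ball 0 1 - ?E"
    then have w: "w \<in> ball 0 1" "w \<in> cover F" "disk_map G w \<notin> E"
      using blaschke_in_disk[OF G(1), of w] by (auto simp: fiber_def)
    obtain p i where p: "path_from_base p" "i \<in> {1..d}" "w = lift_end F p (f i)" "pathfinish p = disk_map F w"
      using cover_cases[OF F w(2)] .
    have "disk_map G w = disk_map A1 (lift_end A p (a i))"
      using G(2)[OF w(2)] block_fun_lift_end[OF F p(1,2)] p(3) A1_lift_end[OF p(1,2)] by simp
    then show "disk_map F w = disk_map C (disk_map G w)"
      using C(3)[OF lift_end_label_cover[OF p(1) labelled_A p(2)]] w(3) lift_end_disk(2)[OF p(1,2)] p(4)
      by simp
  qed
qed

end

text \<open>The degree of \<open>C\<close> exceeds one because \<open>A1\<close> vanishes at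
  \<open>a j0\<close> but not at \<open>a k\<close> for \<open>k\<close> outside the class, so the
  fiber of \<open>C\<close> over \<open>\<zeta>\<close> has two points.\<close>

lemma common_left_factor:
  assumes nontrivial: "sim_class j0 \<noteq> {1..d}"
  shows "\<exists>A1 B1 C. blaschke_product A1 \<and> blaschke_product B1 \<and> blaschke_product C \<and>
    rat_degree C > 1 \<and> A = C \<circ> A1 \<and> B = C \<circ> B1"
proof -
  obtain A1 where A1: "blaschke_product A1" "\<And>w. w \<in> cover A \<Longrightarrow> disk_map A1 w = block_fun A a w"
    using block_fun_extension[OF labelled_A] by blast
  obtain B1 where B1: "blaschke_product B1" "\<And>w. w \<in> cover B \<Longrightarrow> disk_map B1 w = block_fun B b w"
    using block_fun_extension[OF labelled_B] by blast
  obtain C E where C: "blaschke_product C" "finite E"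
    "\<And>w. w \<in> cover A \<Longrightarrow> disk_map A1 w \<notin> E \<Longrightarrow> disk_map C (disk_map A1 w) = disk_map A w"
    using left_factor_exists[OF A1] by blast
  have eqA: "A = C \<circ> A1" and eqB: "B = C \<circ> B1"
    using factor_through_blocks[OF A1 C] labelled_A labelled_B A1 B1 by auto
  obtain k where k: "k \<in> {1..d}" "k \<notin> sim_class j0"
    using nontrivial sim_class_subset by blast
  have "a k \<notin> a ` sim_class j0"
  proof
    assume "a k \<in> a ` sim_class j0"
    then obtain i where i: "i \<in> sim_class j0" "a k = a i" by blast
    then have "k = i"
      using label_inj[OF labelled_A k(1)] by (simp add: sim_class_def)
    then show False using i k(2) by simp
  qed
  moreover have "fiber A1 0 = a ` sim_class j0"
    by (rule fiber_A1_0) (fact A1)+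
  ultimately have "a k \<notin> fiber A1 0" "a j0 \<in> fiber A1 0"
    using sim_class_self[OF j0] by simp_all
  then have ne: "disk_map A1 (a k) \<noteq> disk_map A1 (a j0)"
    using label_fiber[OF labelled_A k(1)] by (auto simp: fiber_def)
  have mem: "disk_map A1 (a i) \<in> fiber C \<zeta>" if "i \<in> {1..d}" for i
    using label_fiber[OF labelled_A that] eqA disk_map_comp[OF A1(1), of "a i" C] blaschke_in_disk[OF A1(1)]
    by (simp add: fiber_def)
  have zeta: "\<zeta> \<in> ball 0 1" using base_in_X X_disk by blast
  have "card {disk_map A1 (a k), disk_map A1 (a j0)} \<le> card (fiber C \<zeta>)"
    using mem k(1) j0 by (intro card_mono finite_blaschke_fiber[OF C(1) zeta]) auto
  then have "rat_degree C > 1"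
    using ne card_blaschke_fiber_le[OF C(1) zeta] by simp
  with A1(1) B1(1) C(1) eqA eqB show ?thesis by blast
qed

end

theorem theorem2:
  fixes A B :: "complex option \<Rightarrow> complex option" and d :: nat and \<zeta> :: complex
  assumes "blaschke_product A" and "blaschke_product B"
    and "rat_degree A = d" and "rat_degree B = d"
    and "\<zeta> \<in> ball 0 1"
    and "\<zeta> \<notin> critical_values A" and "\<zeta> \<notin> critical_values B"
  shows "(\<exists>A\<^sub>1 B\<^sub>1 C. blaschke_product A\<^sub>1 \<and> blaschke_product B\<^sub>1 \<and> blaschke_product C \<and>
             rat_degree C > 1 \<and> A = C \<circ> A\<^sub>1 \<and> B = C \<circ> B\<^sub>1)
     \<longleftrightarrow> (\<exists>a b. labelling A \<zeta> d a \<and> labelling B \<zeta> d b \<and>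
             \<not> trivial_rel_on d (sim_rel A B \<zeta> d a b))"
  (is "?lhs \<longleftrightarrow> ?rhs")
proof
  have reg: "\<zeta> \<in> regular_values A" "\<zeta> \<in> regular_values B"
    using assms by (simp_all add: regular_values_def)
  show ?rhs if ?lhs
    using that nontrivial_labelling_of_common_left_factor[OF assms(1,2) _ _ _ assms(3,4) _ _ _ reg] by metis
  assume ?rhs
  then obtain a b where ab: "labelling A \<zeta> d a" "labelling B \<zeta> d b"
    and nontrivial: "\<not> trivial_rel_on d (sim_rel A B \<zeta> d a b)"
    by blast
  interpret labelled_pair A B d \<zeta> a b
    by unfold_locales (use assms reg ab in simp_all)
  obtain j k where jk: "j \<in> {1..d}" "k \<in> {1..d}" "\<not> sim j k"
    using nontrivial by (auto simp: trivial_rel_on_def)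
  obtain j0 where j0: "j0 \<in> {1..d}" "\<And>i. i \<in> {1..d} \<Longrightarrow> card (sim_class j0) \<le> card (sim_class i)"
    using ex_has_least_nat[of "\<lambda>i. i \<in> {1..d}" j "\<lambda>i. card (sim_class i)"] jk(1) by blast
  interpret minimal_class A B d \<zeta> a b j0
    by unfold_locales (use j0 in simp_all)
  \<comment> \<open>The class was chosen for its size, but if any class were everything, all labels
    would be equivalent.\<close>
  have "sim_class j0 \<noteq> {1..d}"
  proof
    assume "sim_class j0 = {1..d}"
    then have "j \<in> sim_class j0" "k \<in> sim_class j0" using jk(1,2) by simp_all
    then have "sim j0 j" "sim j0 k" by (simp_all add: sim_class_def)
    then show False using jk(3) sim_sym sim_trans by blast
  qed
  then show ?lhs by (rule common_left_factor)
qed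

end
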